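(* Let $M\in A$ be nonconstant with $q\neq2$, or $q=2$ and neither $T$ nor $T+1$ dividing $M$. Let $\Gamma$ be a finitely generated $A$-submodule of $(k,+)$, $\Gamma'=\frac1M\Gamma\cap k$, and let $e(\Gamma'/\Gamma)$ be the monic polynomial of smallest degree such that $(\Gamma')^{e(\Gamma'/\Gamma)}\subseteq\Gamma$. Put $e_M(\Gamma)=\gcd(e(\Gamma'/\Gamma),M)$. Let $\varphi:\Gamma\to\mathrm{Hom}_A(H_\Gamma(M),\Lambda_M)$ be the $A$-module homomorphism $a\mapsto\varphi_a$, $\varphi_a(\sigma)=\sigma\alpha-\alpha$ where $\alpha^M=a$, and let $\Gamma_\varphi=\ker\varphi$. Then $\Gamma_\varphi^{\,e_M(\Gamma)}\subseteq\Gamma^M$.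
   Context: Let $q$ be a prime power, $k=\mathbb{F}_q(T)$, $A=\mathbb{F}_q[T]$, $\bar k$ an algebraic closure of $k$. The Carlitz module is the $A$-module structure on $(\bar k,+)$ given by $T\mapsto\tau+\mu_T$, $\tau(x)=x^q$, $\mu_T(x)=Tx$; $\alpha^M$ denotes the Carlitz action of $M\in A$ on $\alpha$ (not a power), and for a set $S$, $S^N=\{s^N:s\in S\}$. $\Lambda_M=\{\alpha:\alpha^M=0\}$, $K=k(\Lambda_M)$, $\mathrm{Gal}(K/k)\cong(A/(M))^*$ via $\sigma_{\bar B}(\lambda)=\lambda^B$. $\frac1M\Gamma=\{\alpha\in\bar k:\alpha^M\in\Gamma\}$, $k_{M,\Gamma}=k(\Lambda_M,\frac1M\Gamma)$, $H_\Gamma(M)=\mathrm{Gal}(k_{M,\Gamma}/K)$, with the $A$-module structure: for $f\in A$ write $f\equiv\sum_i f_i\pmod M$ with $\gcd(f_i,M)=1$ and set $f\cdot\tau=\sum_i\tilde\sigma_i\tau\tilde\sigma_i^{-1}$ ($\tilde\sigma_i$ any extension of $\sigma_{\bar f_i}$ to $k_{M,\Gamma}$, sum = group law); equivalently $(f\cdot\tau)(\alpha)=\alpha+\lambda^f$ if $\tau(\alpha)=\alpha+\lambda$, $\alpha^M\in\Gamma$. *)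

theory Defs
  imports "HOL-Algebra.Algebra" "HOL-Algebra.Algebraic_Closure_Type" "HOL-Library.Cardinality"
begin

text \<open>
  \<open>'a\<close> is the field with \<open>q = CARD('a)\<close> elements, \<open>'a poly\<close> is the ring \<open>A\<close>, \<open>'a poly fract\<close> is
  the field \<open>k\<close>, and \<open>range to_ac\<close> is \<open>k\<close> as a subfield of its algebraic closure. The sort
  \<open>field_gcd\<close> only provides the (monic) \<open>gcd\<close> on \<open>'a poly\<close>.
\<close>

type_synonym 'a kbar = "'a poly fract alg_closure"

definition of_A :: "'a::field poly \<Rightarrow> 'a kbar"
  where "of_A f = to_ac (to_fract f)"

definition carlitz_T :: "'a::field kbar \<Rightarrow> 'a kbar"
  where "carlitz_T \<alpha> = \<alpha> ^ CARD('a) + of_A [:0, 1:] * \<alpha>"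

definition carlitz :: "'a::field poly \<Rightarrow> 'a kbar \<Rightarrow> 'a kbar"
  where "carlitz f \<alpha> =
    (\<Sum>i\<le>Polynomial.degree f. of_A [:Polynomial.coeff f i:] * (carlitz_T ^^ i) \<alpha>)"

definition carlitz_torsion :: "'a::field poly \<Rightarrow> 'a kbar set"
  where "carlitz_torsion M = {\<alpha>. carlitz M \<alpha> = 0}"

definition carlitz_division :: "'a::field poly \<Rightarrow> 'a kbar set \<Rightarrow> 'a kbar set"
  where "carlitz_division M \<Gamma> = {\<alpha>. carlitz M \<alpha> \<in> \<Gamma>}"

definition adjoin :: "'a::field kbar set \<Rightarrow> 'a kbar set"
  where "adjoin S = generate_field ring_of_type_algebra (range to_ac \<union> S)"

definition cyclotomic_field :: "'a::field poly \<Rightarrow> 'a kbar set"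
  where "cyclotomic_field M = adjoin (carlitz_torsion M)"

definition kummer_field :: "'a::field poly \<Rightarrow> 'a kbar set \<Rightarrow> 'a kbar set"
  where "kummer_field M \<Gamma> = adjoin (carlitz_torsion M \<union> carlitz_division M \<Gamma>)"

text \<open>
  Automorphisms of \<open>L\<close> are extensional functions, so that each of them is represented by exactly
  one HOL function; the group law is composition on \<open>L\<close>.
\<close>

definition galois_group :: "'b::field set \<Rightarrow> 'b set \<Rightarrow> ('b \<Rightarrow> 'b) monoid"
  where "galois_group L F = BijGroup L \<lparr>carrier :=
    {\<sigma> \<in> extensional L.
       \<sigma> \<in> ring_iso (ring_of_type_algebra \<lparr>carrier := L\<rparr>) (ring_of_type_algebra \<lparr>carrier := L\<rparr>) \<and>
       (\<forall>x\<in>F. \<sigma> x = x)}\<rparr>"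

definition kummer_group :: "'a::field poly \<Rightarrow> 'a kbar set \<Rightarrow> ('a kbar \<Rightarrow> 'a kbar) monoid"
  where "kummer_group M \<Gamma> = galois_group (kummer_field M \<Gamma>) (cyclotomic_field M)"

text \<open>
  The \<open>A\<close>-module structure on \<open>kummer_group M \<Gamma>\<close>, as a relation: \<open>kummer_smult M \<Gamma> f \<tau> \<rho>\<close> means
  \<open>\<rho> = f \<cdot> \<tau>\<close>. The list \<open>ps\<close> consists of the pairs of a summand \<open>f\<^sub>i\<close> prime to \<open>M\<close> and an
  automorphism of the Kummer field over \<open>k\<close> that acts on \<open>\<Lambda>\<^sub>M\<close> as \<open>f\<^sub>i\<close> does. By
  \<open>kummer_smult_apply\<close> below, \<open>\<rho>\<close> sends \<open>\<alpha>\<close> to \<open>\<alpha> + \<lambda>\<^sup>f\<close> whenever \<open>\<tau>\<close> sends \<open>\<alpha>\<close> to \<open>\<alpha> + \<lambda>\<close>; a relation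
  avoids choosing the decomposition and the extensions.
\<close>

definition kummer_smult ::
    "'a::field poly \<Rightarrow> 'a kbar set \<Rightarrow> 'a poly \<Rightarrow> ('a kbar \<Rightarrow> 'a kbar) \<Rightarrow> ('a kbar \<Rightarrow> 'a kbar) \<Rightarrow> bool"
  where "kummer_smult M \<Gamma> f \<tau> \<rho> \<longleftrightarrow>
    (let G = galois_group (kummer_field M \<Gamma>) (range to_ac) in
     \<exists>ps. (\<forall>(g, \<sigma>)\<in>set ps. coprime g M \<and> \<sigma> \<in> carrier G \<and>
              (\<forall>x\<in>carlitz_torsion M. \<sigma> x = carlitz g x)) \<and>
          M dvd f - sum_list (map fst ps) \<and>
          \<rho> = foldr (\<lambda>(g, \<sigma>) \<rho>'. (\<sigma> \<otimes>\<^bsub>G\<^esub> \<tau> \<otimes>\<^bsub>G\<^esub> inv\<^bsub>G\<^esub> \<sigma>) \<otimes>\<^bsub>G\<^esub> \<rho>') ps \<one>\<^bsub>G\<^esub>)"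

definition additive_group :: "'b::ab_group_add set \<Rightarrow> 'b monoid"
  where "additive_group S = \<lparr>carrier = S, monoid.mult = (+), one = 0\<rparr>"

definition Hom_A :: "'a::field poly \<Rightarrow> 'a kbar set \<Rightarrow> (('a kbar \<Rightarrow> 'a kbar) \<Rightarrow> 'a kbar) monoid"
  where "Hom_A M \<Gamma> = (let H = kummer_group M \<Gamma> in
    \<lparr>carrier = {h \<in> extensional (carrier H).
        h \<in> hom H (additive_group (carlitz_torsion M)) \<and>
        (\<forall>f. \<forall>\<tau>\<in>carrier H. \<forall>\<rho>\<in>carrier H. kummer_smult M \<Gamma> f \<tau> \<rho> \<longrightarrow> h \<rho> = carlitz f (h \<tau>))},
     monoid.mult = (\<lambda>h h'. \<lambda>\<sigma>\<in>carrier H. h \<sigma> + h' \<sigma>),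
     one = (\<lambda>\<sigma>\<in>carrier H. 0)\<rparr>)"

text \<open>The choice of the \<open>M\<close>-division point \<open>\<alpha>\<close> does not matter, see \<open>kummer_map_eq\<close> below.\<close>

definition kummer_map ::
    "'a::field poly \<Rightarrow> 'a kbar set \<Rightarrow> 'a kbar \<Rightarrow> ('a kbar \<Rightarrow> 'a kbar) \<Rightarrow> 'a kbar"
  where "kummer_map M \<Gamma> a =
    (\<lambda>\<sigma>\<in>carrier (kummer_group M \<Gamma>). let \<alpha> = (SOME \<alpha>. carlitz M \<alpha> = a) in \<sigma> \<alpha> - \<alpha>)"

definition kummer_kernel :: "'a::field poly \<Rightarrow> 'a kbar set \<Rightarrow> 'a kbar set"
  where "kummer_kernel M \<Gamma> = kernel (additive_group \<Gamma>) (Hom_A M \<Gamma>) (kummer_map M \<Gamma>)"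

definition quotient_exponent :: "'a::field kbar set \<Rightarrow> 'a kbar set \<Rightarrow> 'a poly"
  where "quotient_exponent \<Gamma>' \<Gamma> =
    (ARG_MIN Polynomial.degree e. Polynomial.lead_coeff e = 1 \<and> carlitz e ` \<Gamma>' \<subseteq> \<Gamma>)"

definition e_M :: "'a::field_gcd poly \<Rightarrow> 'a kbar set \<Rightarrow> 'a poly"
  where "e_M M \<Gamma> = gcd (quotient_exponent (carlitz_division M \<Gamma> \<inter> range to_ac) \<Gamma>) M"


subsection \<open>The Carlitz module is a module\<close>

lemma of_A_simps [simp]:
  "of_A 0 = 0" "of_A 1 = 1" "of_A (f + g) = of_A f + of_A g" "of_A (f * g) = of_A f * of_A g"
  "of_A (- f) = - of_A f"
  by (simp_all add: of_A_def)

lemma of_A_power [simp]: "of_A (f ^ n) = of_A f ^ n"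
  by (induction n) simp_all

lemma of_A_of_nat [simp]: "of_A (of_nat n) = of_nat n"
  by (induction n) simp_all

lemma of_A_const_power_card:
  "of_A [:c::'a::finite_field:] ^ CARD('a) = of_A [:c:]"
proof -
  have "[:c:] ^ n = [:c ^ n:]" for n
    by (induction n) (simp_all add: one_pCons mult_ac)
  then show ?thesis
    by (metis of_A_power finite_field_power_card_eq_same)
qed

text \<open>
  \<open>(1 + X)\<^sup>q - 1 - X\<^sup>q\<close> has degree less than \<open>q\<close> and vanishes on all of the field, so
  the binomial coefficients in between are divisible by the characteristic.
\<close>

lemma card_choose_eq_0:
  assumes "0 < i" "i < CARD('a::finite_field)"
  shows "of_nat (CARD('a) choose i) = (0 :: 'a)"
proof -
  let ?q = "CARD('a)"
  define P :: "'a poly" where "P = [:1, 1:] ^ ?q - 1 - Polynomial.monom 1 ?q"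
  have co: "Polynomial.coeff ([:1, 1:] ^ ?q) j = (of_nat (?q choose j) :: 'a)" if "j \<le> ?q" for j
    using coeff_linear_poly_power[of j ?q "1::'a" 1] that by simp
  have q: "?q > 0" by simp
  have "Polynomial.degree ([:1, 1::'a:] ^ ?q) \<le> ?q"
    using degree_linear_power[of "1::'a" ?q] by simp
  then have "Polynomial.degree P \<le> ?q"
    unfolding P_def by (intro degree_diff_le) (auto simp: degree_monom_le)
  moreover have "Polynomial.coeff P ?q = 0"
    using q by (simp add: P_def co)
  ultimately have deg: "Polynomial.degree P < ?q"
    using q by (metis P_def co degree_0 leading_coeff_0_iff le_neq_implies_less)
  have "P = 0"
  proof (rule ccontr)
    assume "P \<noteq> 0"
    then have "card {x. poly P x = 0} \<le> Polynomial.degree P"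
      by (rule card_poly_roots_bound)
    moreover have "{x. poly P x = 0} = UNIV"
      by (auto simp: P_def poly_monom finite_field_power_card_eq_same)
    ultimately show False using deg by simp
  qed
  then have "Polynomial.coeff P i = 0" by simp
  then show ?thesis using assms by (simp add: P_def co)
qed

lemma frobenius_add:
  fixes x y :: "'a::finite_field kbar"
  shows "(x + y) ^ CARD('a) = x ^ CARD('a) + y ^ CARD('a)"
proof -
  let ?q = "CARD('a)"
  have z: "of_nat (?q choose i) = (0 :: 'a kbar)" if "0 < i" "i < ?q" for i
  proof -
    have "of_nat (?q choose i) = (0 :: 'a poly)"
      using card_choose_eq_0[OF that] by (simp add: of_nat_poly)
    then show ?thesis by (metis of_A_of_nat of_A_simps(1))
  qed
  have "(x + y) ^ ?q = (\<Sum>i\<le>?q. of_nat (?q choose i) * x ^ i * y ^ (?q - i))"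
    by (rule binomial_ring)
  also have "\<dots> = (\<Sum>i\<in>{0, ?q}. of_nat (?q choose i) * x ^ i * y ^ (?q - i))"
    by (rule sum.mono_neutral_right) (auto simp: z)
  also have "\<dots> = x ^ ?q + y ^ ?q"
    by simp
  finally show ?thesis .
qed

lemma carlitz_T_add: "carlitz_T (x + y) = carlitz_T x + carlitz_T (y :: 'a::finite_field kbar)"
  by (simp add: carlitz_T_def frobenius_add algebra_simps)

lemma carlitz_T_const:
  "carlitz_T (of_A [:c:] * x) = of_A [:c:] * carlitz_T (x :: 'a::finite_field kbar)"
  by (simp add: carlitz_T_def power_mult_distrib of_A_const_power_card algebra_simps)

lemma carlitz_T_pow_add:
  "(carlitz_T ^^ i) (x + y) = (carlitz_T ^^ i) x + (carlitz_T ^^ i) (y :: 'a::finite_field kbar)"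
  by (induction i) (simp_all add: carlitz_T_add)

lemma carlitz_0 [simp]: "carlitz 0 x = 0"
  by (simp add: carlitz_def)

lemma carlitz_altdef:
  assumes "Polynomial.degree f \<le> n"
  shows "carlitz f x = (\<Sum>i\<le>n. of_A [:Polynomial.coeff f i:] * (carlitz_T ^^ i) x)"
  unfolding carlitz_def using assms
  by (intro sum.mono_neutral_left) (auto simp: coeff_eq_0)

lemma carlitz_pCons:
  "carlitz (pCons c f) x = of_A [:c:] * x + carlitz f (carlitz_T x)"
proof -
  have "carlitz (pCons c f) x =
      (\<Sum>i\<le>Suc (Polynomial.degree f). of_A [:Polynomial.coeff (pCons c f) i:] * (carlitz_T ^^ i) x)"
    by (rule carlitz_altdef) (rule degree_pCons_le)
  then show ?thesis
    by (subst (asm) sum.atMost_Suc_shift)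
       (simp add: carlitz_def funpow_swap1 del: funpow.simps(2) add: funpow_Suc_right)
qed

lemma carlitz_right_add: "carlitz f (x + y) = carlitz f x + carlitz f (y :: 'a::finite_field kbar)"
  by (simp add: carlitz_def carlitz_T_pow_add algebra_simps sum.distrib)

lemma carlitz_left_add: "carlitz (f + g) x = carlitz f x + carlitz g x"
proof -
  let ?n = "max (Polynomial.degree f) (Polynomial.degree g)"
  have *: "of_A [:c + d:] = of_A [:c:] + of_A [:d:]" for c d :: 'a
    by (simp flip: of_A_simps(3))
  show ?thesis
    by (subst (1 2 3) carlitz_altdef[where n = ?n])
       (auto simp: degree_add_le * algebra_simps sum.distrib)
qed

lemma carlitz_smult: "carlitz (smult c f) x = of_A [:c:] * carlitz f x"
proof -
  have *: "of_A [:c * d:] = of_A [:c:] * of_A [:d:]" for d :: 'a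
    by (simp add: mult.commute flip: of_A_simps(4))
  show ?thesis
    by (subst carlitz_altdef[where n = "Polynomial.degree f"])
       (auto simp: degree_smult_le carlitz_def * sum_distrib_left mult_ac)
qed

lemma carlitz_carlitz_T: "carlitz f (carlitz_T x) = carlitz_T (carlitz f (x :: 'a::finite_field kbar))"
proof (induction f arbitrary: x)
  case 0
  then show ?case by (simp add: carlitz_T_def zero_power)
next
  case (pCons c f)
  then show ?case by (simp add: carlitz_pCons carlitz_T_add carlitz_T_const)
qed

lemma carlitz_mult: "carlitz (f * g) x = carlitz f (carlitz g (x :: 'a::finite_field kbar))"
proof (induction f arbitrary: x)
  case 0
  then show ?case by simp
next
  case (pCons c f)
  have "carlitz (pCons 0 h) x = carlitz h (carlitz_T x)" for h
    by (simp add: carlitz_pCons)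
  with pCons show ?case
    by (simp add: carlitz_pCons carlitz_left_add carlitz_smult carlitz_carlitz_T)
qed

global_interpretation carlitz: Modules.module "carlitz :: 'a::finite_field poly \<Rightarrow> 'a kbar \<Rightarrow> 'a kbar"
proof
  show "carlitz 1 x = x" for x :: "'a kbar"
    by (simp add: one_pCons carlitz_pCons flip: of_A_simps(2))
qed (simp_all add: carlitz_right_add carlitz_left_add carlitz_mult)


subsection \<open>The exponent is well defined\<close>

lemma quotient_exponent_unique:
  fixes M :: "'a::finite_field poly"
  assumes "M \<noteq> 0" and "carlitz.subspace \<Gamma>" and "\<Gamma>' \<subseteq> carlitz_division M \<Gamma>"
  defines "P \<equiv> \<lambda>e. Polynomial.lead_coeff e = 1 \<and> carlitz e ` \<Gamma>' \<subseteq> \<Gamma>"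
  shows "is_arg_min Polynomial.degree P e \<longleftrightarrow> e = quotient_exponent \<Gamma>' \<Gamma>"
proof -
  have mon: "P (smult (inverse (Polynomial.lead_coeff d)) d)"
    if "d \<noteq> 0" "carlitz d ` \<Gamma>' \<subseteq> \<Gamma>" for d
  proof -
    have "carlitz (smult c d) x \<in> \<Gamma>" if "x \<in> \<Gamma>'" for c x
    proof -
      have "carlitz [:c:] (carlitz d x) \<in> \<Gamma>"
        using that \<open>carlitz d ` \<Gamma>' \<subseteq> \<Gamma>\<close>
        by (auto intro: carlitz.subspace_scale[OF assms(2)] simp del: carlitz.scale_scale)
      then show ?thesis by (simp add: carlitz_pCons carlitz_smult)
    qed
    moreover have "Polynomial.lead_coeff (smult (inverse (Polynomial.lead_coeff d)) d) = 1"
      using that(1) by simp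
    ultimately show ?thesis unfolding P_def by blast
  qed
  have "carlitz M ` \<Gamma>' \<subseteq> \<Gamma>"
    using assms(3) by (auto simp: carlitz_division_def)
  note ex = mon[OF assms(1) this]
  have "is_arg_min Polynomial.degree P (arg_min Polynomial.degree P)"
    using arg_min_natI[of P, OF ex] arg_min_nat_le[of P _ Polynomial.degree]
    unfolding is_arg_min_def by (auto simp: not_less)
  moreover have "d = e" if d: "is_arg_min Polynomial.degree P d" and e: "is_arg_min Polynomial.degree P e"
    for d e
  proof (rule ccontr)
    assume "d \<noteq> e"
    have dP: "P d" and eP: "P e" and min: "\<And>c. P c \<Longrightarrow> Polynomial.degree e \<le> Polynomial.degree c"
      and min': "\<And>c. P c \<Longrightarrow> Polynomial.degree d \<le> Polynomial.degree c"
      using d e unfolding is_arg_min_def by (auto simp: not_less)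
    have deg: "Polynomial.degree d = Polynomial.degree e"
      using min[OF dP] min'[OF eP] by simp
    define c where "c = d - e"
    have "c \<noteq> 0" using \<open>d \<noteq> e\<close> by (simp add: c_def)
    have "carlitz c x \<in> \<Gamma>" if "x \<in> \<Gamma>'" for x
    proof -
      have "carlitz d x \<in> \<Gamma>" "carlitz e x \<in> \<Gamma>" using that dP eP by (auto simp: P_def)
      then show ?thesis
        unfolding c_def carlitz.scale_left_diff_distrib by (rule carlitz.subspace_diff[OF assms(2)])
    qed
    then have "P (smult (inverse (Polynomial.lead_coeff c)) c)"
      using \<open>c \<noteq> 0\<close> by (intro mon) auto
    from min[OF this] have "Polynomial.degree e \<le> Polynomial.degree c"
      using \<open>c \<noteq> 0\<close> by simp
    moreover have "Polynomial.degree c \<le> Polynomial.degree e"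
      unfolding c_def by (rule degree_diff_le) (simp_all add: deg)
    ultimately have "Polynomial.degree c = Polynomial.degree e" by simp
    moreover have "Polynomial.coeff c (Polynomial.degree e) = 0"
      using dP eP deg by (simp add: P_def c_def)
    ultimately show False
      using \<open>c \<noteq> 0\<close> leading_coeff_0_iff[of c] by simp
  qed
  moreover have "quotient_exponent \<Gamma>' \<Gamma> = arg_min Polynomial.degree P"
    by (simp add: quotient_exponent_def P_def)
  ultimately show ?thesis by (metis (no_types, lifting))
qed


subsection \<open>The map \<open>kummer_map\<close> is a homomorphism into \<open>Hom_A\<close>\<close>

lemma adjoin_closed:
  "range to_ac \<union> S \<subseteq> adjoin S"
  "x \<in> adjoin S \<Longrightarrow> y \<in> adjoin S \<Longrightarrow> x + y \<in> adjoin S"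
  "x \<in> adjoin S \<Longrightarrow> y \<in> adjoin S \<Longrightarrow> x * y \<in> adjoin S"
proof -
  let ?R = "ring_of_type_algebra :: 'a kbar ring"
  show "range to_ac \<union> S \<subseteq> adjoin S"
    by (auto simp: adjoin_def intro: generate_field.incl)
  show "x + y \<in> adjoin S" if "x \<in> adjoin S" "y \<in> adjoin S"
    using generate_field.eng_add[of x ?R _ y] that by (simp add: adjoin_def ring_of_type_algebra_def)
  show "x * y \<in> adjoin S" if "x \<in> adjoin S" "y \<in> adjoin S"
    using generate_field.eng_mult[of x ?R _ y] that by (simp add: adjoin_def ring_of_type_algebra_def)
qed

lemma adjoin_mono: "S \<subseteq> S' \<Longrightarrow> adjoin S \<subseteq> adjoin S'"
proof
  show "x \<in> adjoin S'" if "S \<subseteq> S'" "x \<in> adjoin S" for x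
    using that(2,1) unfolding adjoin_def
    by (induction rule: generate_field.induct) (auto intro: generate_field.intros)
qed

lemma adjoin_carlitz:
  assumes "x \<in> adjoin S"
  shows "carlitz f x \<in> adjoin S"
proof -
  have base: "of_A g \<in> adjoin S" for g
    using adjoin_closed(1)[of S] by (auto simp: of_A_def)
  have pow: "y ^ n \<in> adjoin S" if "y \<in> adjoin S" for y n
    using that base[of 1] by (induction n) (auto intro: adjoin_closed)
  have T: "carlitz_T y \<in> adjoin S" if "y \<in> adjoin S" for y
    using that by (auto simp: carlitz_T_def intro!: adjoin_closed(2,3) base pow)
  show ?thesis
    using assms
  proof (induction f arbitrary: x)
    case 0
    then show ?case using base[of 0] by simp
  next
    case (pCons c f)
    then show ?case by (auto simp: carlitz_pCons intro!: adjoin_closed(2,3) base T)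
  qed
qed

lemma galois_groupD:
  assumes "\<sigma> \<in> carrier (galois_group L F)"
  shows "\<sigma> \<in> Bij L" "x \<in> L \<Longrightarrow> \<sigma> x \<in> L"
    "x \<in> L \<Longrightarrow> y \<in> L \<Longrightarrow> \<sigma> (x + y) = \<sigma> x + \<sigma> y"
    "x \<in> L \<Longrightarrow> y \<in> L \<Longrightarrow> \<sigma> (x * y) = \<sigma> x * \<sigma> y"
    "x \<in> F \<Longrightarrow> \<sigma> x = x"
  using assms
  by (auto simp: galois_group_def Bij_def ring_iso_def ring_hom_def ring_of_type_algebra_def Pi_iff)

lemma galois_carlitz:
  assumes "\<sigma> \<in> carrier (galois_group (adjoin S) F)" "range to_ac \<subseteq> F" "x \<in> adjoin S"
  shows "\<sigma> (carlitz f x) = carlitz f (\<sigma> x)"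
proof -
  note \<sigma> = galois_groupD[OF assms(1)]
  have base: "of_A g \<in> adjoin S" "\<sigma> (of_A g) = of_A g" for g
    using adjoin_closed(1)[of S] assms(2) by (auto simp: of_A_def intro!: \<sigma>)
  have pow: "y ^ n \<in> adjoin S \<and> \<sigma> (y ^ n) = \<sigma> y ^ n" if "y \<in> adjoin S" for y n
    using that base[of 1] by (induction n) (auto intro: adjoin_closed simp: \<sigma>)
  have T: "carlitz_T y \<in> adjoin S \<and> \<sigma> (carlitz_T y) = carlitz_T (\<sigma> y)" if "y \<in> adjoin S" for y
    using that by (simp add: carlitz_T_def adjoin_closed base pow \<sigma>)
  show ?thesis
    using assms(3)
  proof (induction f arbitrary: x)
    case 0
    then show ?case using base[of 0] by simp
  next
    case (pCons c f)
    then show ?case by (simp add: carlitz_pCons adjoin_closed base T adjoin_carlitz \<sigma>)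
  qed
qed

lemma group_galois_group:
  assumes "\<And>x y. x \<in> L \<Longrightarrow> y \<in> L \<Longrightarrow> x + y \<in> L" "\<And>x y. x \<in> L \<Longrightarrow> y \<in> L \<Longrightarrow> x * y \<in> L"
    "1 \<in> L" "F \<subseteq> L"
  shows "subgroup (carrier (galois_group L F)) (BijGroup L)"
proof -
  have eq: "carrier (galois_group L F) = {\<sigma> \<in> Bij L. (\<forall>x\<in>L. \<forall>y\<in>L. \<sigma> (x + y) = \<sigma> x + \<sigma> y \<and>
      \<sigma> (x * y) = \<sigma> x * \<sigma> y) \<and> \<sigma> 1 = 1 \<and> (\<forall>x\<in>F. \<sigma> x = x)}"
    by (auto simp: galois_group_def Bij_def ring_iso_def ring_hom_def ring_of_type_algebra_def
        bij_betw_imp_funcset)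
       (auto simp: bij_betw_def)
  show ?thesis
  proof
    show "carrier (galois_group L F) \<subseteq> carrier (BijGroup L)"
      by (auto simp: eq BijGroup_def)
    show "\<one>\<^bsub>BijGroup L\<^esub> \<in> carrier (galois_group L F)"
      using assms by (auto simp: eq BijGroup_def id_Bij)
    show "\<sigma> \<otimes>\<^bsub>BijGroup L\<^esub> \<tau> \<in> carrier (galois_group L F)"
      if "\<sigma> \<in> carrier (galois_group L F)" "\<tau> \<in> carrier (galois_group L F)" for \<sigma> \<tau>
    proof -
      have "\<tau> x \<in> L" if "x \<in> L" for x
        using galois_groupD(2) \<open>\<tau> \<in> _\<close> that by metis
      then show ?thesis
        using assms that by (auto simp: eq BijGroup_def compose_Bij compose_eq subset_iff)
    qed
    show "inv\<^bsub>BijGroup L\<^esub> \<sigma> \<in> carrier (galois_group L F)"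
      if "\<sigma> \<in> carrier (galois_group L F)" for \<sigma>
    proof -
      have \<sigma>: "\<sigma> \<in> Bij L" using that by (simp add: eq)
      have inv1: "inv_into L \<sigma> x = x" if "x \<in> L" "\<sigma> x = x" for x
        using \<sigma> that by (metis Bij_def Int_iff bij_betw_inv_into_left mem_Collect_eq)
      have "inv_into L \<sigma> (x + y) = inv_into L \<sigma> x + inv_into L \<sigma> y" if "x \<in> L" "y \<in> L" for x y
        using \<open>\<sigma> \<in> carrier _\<close> that assms(1) by (intro Bij_inv_into_lemma[OF _ \<sigma>]) (auto simp: eq)
      moreover have "inv_into L \<sigma> (x * y) = inv_into L \<sigma> x * inv_into L \<sigma> y" if "x \<in> L" "y \<in> L" for x y
        using \<open>\<sigma> \<in> carrier _\<close> that assms(2) by (intro Bij_inv_into_lemma[OF _ \<sigma>]) (auto simp: eq)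
      ultimately show ?thesis
        using that assms \<sigma> inv1
        by (auto simp: eq inv_BijGroup restrict_inv_into_Bij subset_iff)
    qed
  qed
qed

lemma galois_group_adjoin:
  assumes "F \<subseteq> adjoin S"
  shows "group (galois_group (adjoin S) F)"
    "\<sigma> \<in> carrier (galois_group (adjoin S) F) \<Longrightarrow>
      inv\<^bsub>galois_group (adjoin S) F\<^esub> \<sigma> = (\<lambda>x\<in>adjoin S. inv_into (adjoin S) \<sigma> x)"
    "\<sigma> \<in> carrier (galois_group (adjoin S) F) \<Longrightarrow> \<tau> \<in> carrier (galois_group (adjoin S) F) \<Longrightarrow>
      x \<in> adjoin S \<Longrightarrow> (\<sigma> \<otimes>\<^bsub>galois_group (adjoin S) F\<^esub> \<tau>) x = \<sigma> (\<tau> x)"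
    "x \<in> adjoin S \<Longrightarrow> \<one>\<^bsub>galois_group (adjoin S) F\<^esub> x = x"
proof -
  let ?L = "adjoin S" and ?G = "galois_group (adjoin S) F"
  have one: "1 \<in> ?L"
    using adjoin_closed(1)[of S] by (metis UnI1 rangeI subsetD to_ac_1)
  have sub: "subgroup (carrier ?G) (BijGroup ?L)"
    by (intro group_galois_group adjoin_closed one assms)
  have G: "?G = BijGroup ?L \<lparr>carrier := carrier ?G\<rparr>"
    by (simp add: galois_group_def)
  show "group ?G"
    using subgroup.subgroup_is_group[OF sub group_BijGroup] G by simp
  show "inv\<^bsub>?G\<^esub> \<sigma> = (\<lambda>x\<in>?L. inv_into ?L \<sigma> x)" if "\<sigma> \<in> carrier ?G"
    using group.m_inv_consistent[OF group_BijGroup sub that] G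
      inv_BijGroup[OF galois_groupD(1)[OF that]] by simp
  show "(\<sigma> \<otimes>\<^bsub>?G\<^esub> \<tau>) x = \<sigma> (\<tau> x)" if "\<sigma> \<in> carrier ?G" "\<tau> \<in> carrier ?G" "x \<in> ?L"
    using that galois_groupD(1)[OF that(1)] galois_groupD(1)[OF that(2)]
    by (simp add: galois_group_def BijGroup_def compose_eq)
  show "\<one>\<^bsub>?G\<^esub> x = x" if "x \<in> ?L"
    using that by (simp add: galois_group_def BijGroup_def)
qed

lemma carlitz_as_poly:
  fixes f :: "'a::finite_field poly"
  assumes "f \<noteq> 0"
  shows "\<exists>P. (\<forall>x. poly P x = carlitz f x) \<and> Polynomial.degree P = CARD('a) ^ Polynomial.degree f"
  using assms
proof (induction f rule: pCons_induct)
  case 0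
  then show ?case by simp
next
  case (pCons c f)
  have q: "CARD('a) > 1"
    using card_mono[of "UNIV :: 'a set" "{0, 1}"] by simp
  show ?case
  proof (cases "f = 0")
    case True
    with pCons have "c \<noteq> 0" by auto
    then have "of_A [:c:] \<noteq> 0" by (simp add: of_A_def)
    with True show ?thesis
      by (intro exI[of _ "[:0, of_A [:c:]:]"]) (simp add: carlitz_pCons)
  next
    case False
    then obtain P where P: "\<And>x. poly P x = carlitz f x"
      "Polynomial.degree P = CARD('a) ^ Polynomial.degree f"
      using pCons by blast
    define Q where "Q = Polynomial.monom 1 CARD('a) + [:0, of_A [:0, 1::'a:]:]"
    have Q: "poly Q x = carlitz_T x" for x
      by (simp add: Q_def carlitz_T_def poly_monom)
    have "Polynomial.degree Q = CARD('a)"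
      unfolding Q_def using q by (subst degree_add_eq_left) (auto simp: degree_monom_eq)
    then have deg: "Polynomial.degree (pcompose P Q) = CARD('a) ^ Suc (Polynomial.degree f)"
      by (simp add: degree_pcompose P)
    moreover have "CARD('a) ^ Suc (Polynomial.degree f) > 1"
      using q by (intro one_less_power) auto
    ultimately have "Polynomial.degree ([:0, of_A [:c:]:] + pcompose P Q) =
        CARD('a) ^ Suc (Polynomial.degree f)"
      by (subst degree_add_eq_right) auto
    then show ?thesis
      using False
      by (intro exI[of _ "[:0, of_A [:c:]:] + pcompose P Q"])
         (simp add: carlitz_pCons poly_pcompose P Q mult.commute)
  qed
qed

lemma carlitz_surj:
  fixes M :: "'a::finite_field poly"
  assumes "M \<noteq> 0"
  obtains \<alpha> where "carlitz M \<alpha> = a"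
proof -
  obtain P where P: "\<And>x. poly P x = carlitz M x"
    "Polynomial.degree P = CARD('a) ^ Polynomial.degree M"
    using carlitz_as_poly[OF assms] by blast
  have "Polynomial.degree (P + [:- a:]) > 0"
    using P by (subst degree_add_eq_left) auto
  then obtain x where "poly (P + [:- a:]) x = 0"
    using alg_closed_imp_poly_has_root by blast
  then show ?thesis using that[of x] P by simp
qed

lemma kummer_field_facts:
  "range to_ac \<subseteq> cyclotomic_field M" "carlitz_torsion M \<subseteq> cyclotomic_field M"
  "cyclotomic_field M \<subseteq> kummer_field M \<Gamma>" "carlitz_division M \<Gamma> \<subseteq> kummer_field M \<Gamma>"
  using adjoin_closed(1)[of "carlitz_torsion M"]
    adjoin_closed(1)[of "carlitz_torsion M \<union> carlitz_division M \<Gamma>"]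
  by (auto simp: cyclotomic_field_def kummer_field_def intro: subsetD[OF adjoin_mono])

lemma kummer_groupD:
  fixes M :: "'a::finite_field poly"
  assumes "\<sigma> \<in> carrier (kummer_group M \<Gamma>)" "\<alpha> \<in> carlitz_division M \<Gamma>"
  shows "carlitz M \<beta> = carlitz M \<alpha> \<Longrightarrow> \<sigma> \<beta> - \<beta> = \<sigma> \<alpha> - \<alpha>"
    and "\<Gamma> \<subseteq> range to_ac \<Longrightarrow> carlitz M (\<sigma> \<alpha>) = carlitz M \<alpha>"
proof -
  note facts = kummer_field_facts(1,2)[of M] kummer_field_facts(3,4)[of M \<Gamma>]
  note \<sigma> = galois_groupD[OF assms(1)[unfolded kummer_group_def]]
  show "\<sigma> \<beta> - \<beta> = \<sigma> \<alpha> - \<alpha>" if "carlitz M \<beta> = carlitz M \<alpha>"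
  proof -
    have "\<beta> - \<alpha> \<in> carlitz_torsion M"
      using that by (simp add: carlitz_torsion_def carlitz.scale_right_diff_distrib)
    then have "\<sigma> (\<beta> - \<alpha>) = \<beta> - \<alpha>" "\<beta> - \<alpha> \<in> kummer_field M \<Gamma>"
      using facts by (auto intro: \<sigma>)
    moreover have "\<alpha> \<in> kummer_field M \<Gamma>" using assms(2) facts by auto
    ultimately have "\<sigma> (\<alpha> + (\<beta> - \<alpha>)) = \<sigma> \<alpha> + (\<beta> - \<alpha>)" by (simp only: \<sigma>)
    then show ?thesis by (simp add: algebra_simps)
  qed
  show "carlitz M (\<sigma> \<alpha>) = carlitz M \<alpha>" if "\<Gamma> \<subseteq> range to_ac"
  proof -
    have "\<sigma> (carlitz M \<alpha>) = carlitz M (\<sigma> \<alpha>)"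
      using assms facts
      by (intro galois_carlitz[where F = "cyclotomic_field M"])
         (auto simp: kummer_group_def kummer_field_def)
    moreover have "carlitz M \<alpha> \<in> cyclotomic_field M"
      using assms(2) that facts by (auto simp: carlitz_division_def)
    ultimately show ?thesis by (simp add: \<sigma>)
  qed
qed

lemma kummer_map_eq:
  fixes M :: "'a::finite_field poly"
  assumes "\<sigma> \<in> carrier (kummer_group M \<Gamma>)" "carlitz M \<alpha> \<in> \<Gamma>"
  shows "kummer_map M \<Gamma> (carlitz M \<alpha>) \<sigma> = \<sigma> \<alpha> - \<alpha>"
proof -
  define \<beta> where "\<beta> = (SOME \<beta>. carlitz M \<beta> = carlitz M \<alpha>)"
  have "carlitz M \<beta> = carlitz M \<alpha>" unfolding \<beta>_def by (rule someI) (rule refl)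
  then have "\<sigma> \<beta> - \<beta> = \<sigma> \<alpha> - \<alpha>"
    using assms by (intro kummer_groupD(1)[OF assms(1)]) (simp_all add: carlitz_division_def)
  then show ?thesis using assms(1) by (simp add: kummer_map_def \<beta>_def)
qed

lemma kummer_smult_apply:
  fixes M :: "'a::finite_field poly"
  assumes "\<Gamma> \<subseteq> range to_ac" "\<tau> \<in> carrier (kummer_group M \<Gamma>)"
    "kummer_smult M \<Gamma> f \<tau> \<rho>" "\<alpha> \<in> carlitz_division M \<Gamma>"
  shows "\<rho> \<alpha> = \<alpha> + carlitz f (\<tau> \<alpha> - \<alpha>)"
proof -
  let ?L = "kummer_field M \<Gamma>"
  define G where "G = galois_group ?L (range to_ac)"
  define l where "l = \<tau> \<alpha> - \<alpha>"
  note facts = kummer_field_facts(1,2)[of M] kummer_field_facts(3,4)[of M \<Gamma>]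
  have base: "range to_ac \<subseteq> ?L" using facts by blast
  note grp = galois_group_adjoin[OF base[unfolded kummer_field_def], folded kummer_field_def, folded G_def]
  interpret G: Group.group G by (rule grp)
  have GD: "\<sigma> \<in> Bij ?L" "x \<in> ?L \<Longrightarrow> \<sigma> x \<in> ?L"
    "x \<in> ?L \<Longrightarrow> y \<in> ?L \<Longrightarrow> \<sigma> (x + y) = \<sigma> x + \<sigma> y" "x \<in> range to_ac \<Longrightarrow> \<sigma> x = x"
    "x \<in> ?L \<Longrightarrow> \<sigma> (carlitz g x) = carlitz g (\<sigma> x)"
    if "\<sigma> \<in> carrier G" for \<sigma> x y g
    using that galois_groupD(1)[of \<sigma> ?L "range to_ac"] galois_groupD(2,5)[of \<sigma> ?L "range to_ac" x] galois_groupD(3)[of \<sigma> ?L "range to_ac" x y]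
      galois_carlitz[of \<sigma> "carlitz_torsion M \<union> carlitz_division M \<Gamma>" "range to_ac" x g]
    by (auto simp: G_def kummer_field_def)
  have \<tau>G: "\<tau> \<in> carrier G"
    using assms(2) subsetD[OF facts(1)] by (simp add: kummer_group_def G_def galois_group_def)
  have l: "l \<in> carlitz_torsion M"
    using kummer_groupD(2)[OF assms(2,4,1)]
    by (simp add: l_def carlitz_torsion_def carlitz.scale_right_diff_distrib)
  have lL: "l \<in> ?L" using l facts by auto
  have inL: "\<beta> \<in> ?L" if "carlitz M \<beta> = carlitz M \<alpha>" for \<beta>
    using that assms(4) facts(4) by (auto simp: carlitz_division_def)
  have conj: "(\<sigma> \<otimes>\<^bsub>G\<^esub> \<tau> \<otimes>\<^bsub>G\<^esub> inv\<^bsub>G\<^esub> \<sigma>) \<beta> = \<beta> + carlitz g l"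
    if \<sigma>: "\<sigma> \<in> carrier G" "\<forall>x\<in>carlitz_torsion M. \<sigma> x = carlitz g x"
      and \<beta>: "carlitz M \<beta> = carlitz M \<alpha>" for \<sigma> g \<beta>
  proof -
    define \<gamma> where "\<gamma> = (inv\<^bsub>G\<^esub> \<sigma>) \<beta>"
    have i: "inv\<^bsub>G\<^esub> \<sigma> \<in> carrier G" using \<sigma> by simp
    have \<gamma>L: "\<gamma> \<in> ?L" unfolding \<gamma>_def by (rule GD(2)[OF i inL[OF \<beta>]])
    have "\<sigma> \<gamma> = \<beta>"
      using grp(3)[OF \<sigma>(1) i inL[OF \<beta>]] grp(4)[OF inL[OF \<beta>]] \<sigma> by (simp add: \<gamma>_def)
    have "carlitz M \<gamma> = (inv\<^bsub>G\<^esub> \<sigma>) (carlitz M \<beta>)"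
      unfolding \<gamma>_def by (rule GD(5)[OF i inL[OF \<beta>], symmetric])
    also have "\<dots> = carlitz M \<alpha>"
      unfolding \<beta> using assms(1,4) by (intro GD(4)[OF i]) (auto simp: carlitz_division_def)
    finally have "\<tau> \<gamma> - \<gamma> = l"
      unfolding l_def by (rule kummer_groupD(1)[OF assms(2,4)])
    then have "\<tau> \<gamma> = \<gamma> + l" by (simp add: algebra_simps)
    then have "\<sigma> (\<tau> \<gamma>) = \<beta> + carlitz g l"
      using GD(3)[OF \<sigma>(1) \<gamma>L lL] \<sigma>(2) l \<open>\<sigma> \<gamma> = \<beta>\<close> by simp
    moreover have "(\<sigma> \<otimes>\<^bsub>G\<^esub> \<tau> \<otimes>\<^bsub>G\<^esub> inv\<^bsub>G\<^esub> \<sigma>) \<beta> = \<sigma> (\<tau> \<gamma>)"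
      using grp(3)[OF _ i inL[OF \<beta>]] grp(3)[OF \<sigma>(1) \<tau>G \<gamma>L] \<sigma>(1) \<tau>G by (simp add: \<gamma>_def)
    ultimately show ?thesis by simp
  qed
  define R where "R ps = foldr (\<lambda>(g, \<sigma>) \<rho>'. (\<sigma> \<otimes>\<^bsub>G\<^esub> \<tau> \<otimes>\<^bsub>G\<^esub> inv\<^bsub>G\<^esub> \<sigma>) \<otimes>\<^bsub>G\<^esub> \<rho>') ps \<one>\<^bsub>G\<^esub>"
    for ps :: "('a poly \<times> _) list"
  have R: "R ps \<in> carrier G \<and> R ps \<alpha> = \<alpha> + carlitz (sum_list (map fst ps)) l"
    if "\<forall>(g, \<sigma>)\<in>set ps. coprime g M \<and> \<sigma> \<in> carrier G \<and> (\<forall>x\<in>carlitz_torsion M. \<sigma> x = carlitz g x)"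
    for ps
    using that
  proof (induction ps)
    case Nil
    then show ?case using grp(4)[OF inL[OF refl]] by (simp add: R_def)
  next
    case (Cons p ps)
    obtain g \<sigma> where p: "p = (g, \<sigma>)" by fastforce
    have \<sigma>: "\<sigma> \<in> carrier G" "\<forall>x\<in>carlitz_torsion M. \<sigma> x = carlitz g x" using Cons.prems p by auto
    have IH: "R ps \<in> carrier G" "R ps \<alpha> = \<alpha> + carlitz (sum_list (map fst ps)) l"
      using Cons by auto
    have eq: "R (p # ps) = (\<sigma> \<otimes>\<^bsub>G\<^esub> \<tau> \<otimes>\<^bsub>G\<^esub> inv\<^bsub>G\<^esub> \<sigma>) \<otimes>\<^bsub>G\<^esub> R ps"
      by (simp add: R_def p)
    have c: "\<sigma> \<otimes>\<^bsub>G\<^esub> \<tau> \<otimes>\<^bsub>G\<^esub> inv\<^bsub>G\<^esub> \<sigma> \<in> carrier G" using \<sigma> \<tau>G by simp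
    have "carlitz M l = 0" using l by (simp add: carlitz_torsion_def)
    then have "carlitz M (R ps \<alpha>) = carlitz M \<alpha>"
      by (simp add: IH carlitz_right_add carlitz.scale_left_commute[of M] del: carlitz.scale_scale)
    then have "(\<sigma> \<otimes>\<^bsub>G\<^esub> \<tau> \<otimes>\<^bsub>G\<^esub> inv\<^bsub>G\<^esub> \<sigma>) (R ps \<alpha>) = R ps \<alpha> + carlitz g l"
      by (rule conj[OF \<sigma>])
    then show ?case
      using IH c grp(3)[OF c IH(1) inL[OF refl]] unfolding eq
      by (simp add: p carlitz_left_add algebra_simps)
  qed
  obtain ps where ps: "\<forall>(g, \<sigma>)\<in>set ps. coprime g M \<and> \<sigma> \<in> carrier G \<and>
      (\<forall>x\<in>carlitz_torsion M. \<sigma> x = carlitz g x)"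
    "M dvd f - sum_list (map fst ps)" "\<rho> = R ps"
    using assms(3) unfolding kummer_smult_def Let_def R_def G_def by blast
  obtain d where "f - sum_list (map fst ps) = M * d" using ps(2) by (elim dvdE)
  then have "f = d * M + sum_list (map fst ps)" by (simp add: algebra_simps)
  moreover have "carlitz (d * M) l = 0"
    using l by (simp add: carlitz_mult carlitz_torsion_def del: carlitz.scale_scale)
  ultimately have "carlitz f l = carlitz (sum_list (map fst ps)) l"
    by (simp add: carlitz_left_add)
  then show ?thesis using R[OF ps(1)] ps(3) by (simp add: l_def)
qed

lemma kummer_map_in_Hom_A:
  fixes M :: "'a::finite_field poly"
  assumes "M \<noteq> 0" "\<Gamma> \<subseteq> range to_ac" "a \<in> \<Gamma>"
  shows "kummer_map M \<Gamma> a \<in> carrier (Hom_A M \<Gamma>)"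
proof -
  let ?H = "kummer_group M \<Gamma>" and ?L = "kummer_field M \<Gamma>"
  note facts = kummer_field_facts(1,2)[of M] kummer_field_facts(3,4)[of M \<Gamma>]
  obtain \<alpha> where \<alpha>: "carlitz M \<alpha> = a" using carlitz_surj[OF assms(1)] .
  have \<alpha>d: "\<alpha> \<in> carlitz_division M \<Gamma>" using \<alpha> assms by (simp add: carlitz_division_def)
  then have \<alpha>L: "\<alpha> \<in> ?L" using facts by auto
  have eq: "kummer_map M \<Gamma> a \<sigma> = \<sigma> \<alpha> - \<alpha>" if "\<sigma> \<in> carrier ?H" for \<sigma>
    using kummer_map_eq[OF that, of \<alpha>] \<alpha> assms by simp
  have torsion: "\<sigma> \<alpha> - \<alpha> \<in> carlitz_torsion M" if "\<sigma> \<in> carrier ?H" for \<sigma>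
    using kummer_groupD(2)[OF that \<alpha>d assms(2)]
    by (simp add: carlitz_torsion_def carlitz.scale_right_diff_distrib)
  note grp = galois_group_adjoin[OF facts(3)[unfolded kummer_field_def], folded kummer_field_def kummer_group_def]
  interpret H: Group.group ?H using grp(1) .
  have "kummer_map M \<Gamma> a (\<sigma> \<otimes>\<^bsub>?H\<^esub> \<tau>) = kummer_map M \<Gamma> a \<sigma> + kummer_map M \<Gamma> a \<tau>"
    if "\<sigma> \<in> carrier ?H" "\<tau> \<in> carrier ?H" for \<sigma> \<tau>
  proof -
    have "\<sigma> (\<tau> \<alpha>) - \<tau> \<alpha> = \<sigma> \<alpha> - \<alpha>"
      by (rule kummer_groupD(1)[OF that(1) \<alpha>d kummer_groupD(2)[OF that(2) \<alpha>d assms(2)]])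
    then show ?thesis
      using that grp(3)[OF that \<alpha>L] by (simp add: eq algebra_simps)
  qed
  then have "kummer_map M \<Gamma> a \<in> hom ?H (additive_group (carlitz_torsion M))"
    by (auto simp: hom_def additive_group_def eq torsion)
  moreover have "kummer_map M \<Gamma> a \<rho> = carlitz f (kummer_map M \<Gamma> a \<tau>)"
    if "\<tau> \<in> carrier ?H" "\<rho> \<in> carrier ?H" "kummer_smult M \<Gamma> f \<tau> \<rho>" for f \<tau> \<rho>
    using kummer_smult_apply[OF assms(2) that(1,3) \<alpha>d] that by (simp add: eq)
  moreover have "kummer_map M \<Gamma> a \<in> extensional (carrier ?H)"
    by (simp add: kummer_map_def)
  ultimately show ?thesis by (simp add: Hom_A_def Let_def)
qed

lemma kummer_map_linear:
  fixes M :: "'a::finite_field poly"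
  assumes "M \<noteq> 0" "\<Gamma> \<subseteq> range to_ac" "carlitz.subspace \<Gamma>" "a \<in> \<Gamma>" "b \<in> \<Gamma>"
  shows "kummer_map M \<Gamma> (a + b) = kummer_map M \<Gamma> a \<otimes>\<^bsub>Hom_A M \<Gamma>\<^esub> kummer_map M \<Gamma> b"
    and "kummer_map M \<Gamma> (carlitz f a) =
      (\<lambda>\<sigma>\<in>carrier (kummer_group M \<Gamma>). carlitz f (kummer_map M \<Gamma> a \<sigma>))"
proof -
  let ?H = "kummer_group M \<Gamma>" and ?L = "kummer_field M \<Gamma>"
  note facts = kummer_field_facts(1,2)[of M] kummer_field_facts(3,4)[of M \<Gamma>]
  obtain \<alpha> where \<alpha>: "carlitz M \<alpha> = a" using carlitz_surj[OF assms(1)] .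
  obtain \<beta> where \<beta>: "carlitz M \<beta> = b" using carlitz_surj[OF assms(1)] .
  have L: "\<alpha> \<in> ?L" "\<beta> \<in> ?L" using \<alpha> \<beta> assms facts by (auto simp: carlitz_division_def)
  have ext: "kummer_map M \<Gamma> c \<in> extensional (carrier ?H)" for c
    by (simp add: kummer_map_def)
  show "kummer_map M \<Gamma> (a + b) = kummer_map M \<Gamma> a \<otimes>\<^bsub>Hom_A M \<Gamma>\<^esub> kummer_map M \<Gamma> b"
  proof (rule extensionalityI[OF ext])
    show "kummer_map M \<Gamma> a \<otimes>\<^bsub>Hom_A M \<Gamma>\<^esub> kummer_map M \<Gamma> b \<in> extensional (carrier ?H)"
      by (simp add: Hom_A_def Let_def)
    fix \<sigma> assume \<sigma>: "\<sigma> \<in> carrier ?H"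
    have "kummer_map M \<Gamma> (carlitz M (\<alpha> + \<beta>)) \<sigma> = \<sigma> (\<alpha> + \<beta>) - (\<alpha> + \<beta>)"
      using \<alpha> \<beta> assms by (intro kummer_map_eq[OF \<sigma>])
        (simp add: carlitz_right_add carlitz.subspace_add)
    also have "\<dots> = (\<sigma> \<alpha> - \<alpha>) + (\<sigma> \<beta> - \<beta>)"
      using galois_groupD(3)[OF \<sigma>[unfolded kummer_group_def] L] by simp
    finally show "kummer_map M \<Gamma> (a + b) \<sigma> =
        (kummer_map M \<Gamma> a \<otimes>\<^bsub>Hom_A M \<Gamma>\<^esub> kummer_map M \<Gamma> b) \<sigma>"
      using kummer_map_eq[OF \<sigma>, of \<alpha>] kummer_map_eq[OF \<sigma>, of \<beta>] \<sigma> \<alpha> \<beta> assms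
      by (simp add: carlitz_right_add Hom_A_def Let_def)
  qed
  show "kummer_map M \<Gamma> (carlitz f a) =
      (\<lambda>\<sigma>\<in>carrier (kummer_group M \<Gamma>). carlitz f (kummer_map M \<Gamma> a \<sigma>))"
  proof (rule extensionalityI[OF ext])
    fix \<sigma> assume \<sigma>: "\<sigma> \<in> carrier ?H"
    have fa: "carlitz M (carlitz f \<alpha>) = carlitz f a"
      using \<alpha> carlitz.scale_left_commute by blast
    have "kummer_map M \<Gamma> (carlitz M (carlitz f \<alpha>)) \<sigma> = \<sigma> (carlitz f \<alpha>) - carlitz f \<alpha>"
      using assms by (intro kummer_map_eq[OF \<sigma>]) (simp only: fa carlitz.subspace_scale)
    also have "\<sigma> (carlitz f \<alpha>) = carlitz f (\<sigma> \<alpha>)"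
      using \<sigma> L facts by (intro galois_carlitz[where F = "cyclotomic_field M"])
        (auto simp: kummer_group_def kummer_field_def)
    finally show "kummer_map M \<Gamma> (carlitz f a) \<sigma> =
        (\<lambda>\<sigma>\<in>carrier (kummer_group M \<Gamma>). carlitz f (kummer_map M \<Gamma> a \<sigma>)) \<sigma>"
      using kummer_map_eq[OF \<sigma>, of \<alpha>] \<sigma> \<alpha> assms fa
      by (simp add: carlitz.scale_right_diff_distrib del: carlitz.scale_scale)
  qed simp
qed

end

theory Submission
  imports Defs
begin

text \<open>
  Let \<open>a\<close> be in the kernel and \<open>\<alpha>\<^sup>M = a\<close>. Since \<open>C\<^sub>M(X) - a\<close> is separable, Galois theory gives
  \<open>\<alpha> \<in> K = k(\<Lambda>\<^sub>M)\<close>. The hypothesis on \<open>q\<close> and \<open>M\<close> provides a monic \<open>B\<close> with \<open>B\<close> and \<open>B - 1\<close> prime to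
  \<open>M\<close>: a translate of \<open>M\<close> by a constant other than \<open>0\<close> and \<open>1\<close> if \<open>q \<noteq> 2\<close>, and \<open>T\<close> if \<open>q = 2\<close>. As \<open>B\<close> is a
  product of monic primes, a product of Frobenius elements acts on \<open>\<Lambda>\<^sub>M\<close> as \<open>B\<close>. Because \<open>B - 1\<close> acts
  invertibly on \<open>\<Lambda>\<^sub>M\<close>, the cocycle \<open>\<sigma> \<mapsto> \<sigma>\<alpha> - \<alpha>\<close> of \<open>Gal(K/k)\<close> is a coboundary, so \<open>a = \<beta>\<^sup>M\<close> with
  \<open>\<beta> \<in> k\<close>. Finally \<open>e\<^sub>M = u e + v M\<close> yields \<open>a\<^bsup>e_M\<^esup> = (\<beta>\<^bsup>ue\<^esup> + a\<^sup>v)\<^sup>M\<close> with \<open>\<beta>\<^sup>e \<in> \<Gamma>\<close>.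
\<close>

section \<open>Extending homomorphisms to an algebraic closure\<close>

text \<open>
  A homomorphism over \<open>k\<close> from an intermediate ring to the algebraic closure is represented by
  its graph, i.e. a subring of the product ring that contains the diagonal of \<open>k\<close> and whose only
  element above \<open>0\<close> is \<open>(0, 0)\<close>.
\<close>

definition partial_hom :: "('b::field alg_closure \<times> 'b alg_closure) set \<Rightarrow> bool"
  where "partial_hom R \<longleftrightarrow> (\<forall>c. (to_ac c, to_ac c) \<in> R) \<and>
    (\<forall>x y x' y'. (x, y) \<in> R \<longrightarrow> (x', y') \<in> R \<longrightarrow> (x + x', y + y') \<in> R \<and> (x * x', y * y') \<in> R) \<and>
    (\<forall>y. (0, y) \<in> R \<longrightarrow> y = 0)"

text \<open>Endomorphisms of the whole closure rather than of a finite extension, so that they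
  compose freely; they are restricted to a Kummer field only where its group is needed.\<close>

definition ac_hom :: "('b::field alg_closure \<Rightarrow> 'b alg_closure) \<Rightarrow> bool"
  where "ac_hom \<sigma> \<longleftrightarrow> (\<forall>x y. \<sigma> (x + y) = \<sigma> x + \<sigma> y \<and> \<sigma> (x * y) = \<sigma> x * \<sigma> y) \<and>
    (\<forall>c. \<sigma> (to_ac c) = to_ac c)"

text \<open>If \<open>R\<close> is the graph of a homomorphism, \<open>q\<close> is the image of
  \<open>p\<close> under it. Letting \<open>i\<close> run over all indices forces
  \<open>(0, 0) \<in> R\<close>.\<close>

definition rel_poly :: "('b \<times> 'c) set \<Rightarrow> 'b::zero poly \<Rightarrow> 'c::zero poly \<Rightarrow> bool"
  where "rel_poly R p q \<longleftrightarrow> (\<forall>i. (Polynomial.coeff p i, Polynomial.coeff q i) \<in> R)"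

lemma rel_poly_pCons [simp]:
  "rel_poly R (pCons a p) (pCons b q) \<longleftrightarrow> (a, b) \<in> R \<and> rel_poly R p q"
  by (auto simp: rel_poly_def coeff_pCons split: nat.splits)

context
  fixes R :: "('b::field alg_closure \<times> 'b alg_closure) set"
  assumes R: "partial_hom R"
begin

lemma partial_hom_base: "(to_ac c, to_ac c) \<in> R"
  and partial_hom_add: "(x, y) \<in> R \<Longrightarrow> (x', y') \<in> R \<Longrightarrow> (x + x', y + y') \<in> R"
  and partial_hom_mult: "(x, y) \<in> R \<Longrightarrow> (x', y') \<in> R \<Longrightarrow> (x * x', y * y') \<in> R"
  and partial_hom_zeroD: "(0, y) \<in> R \<Longrightarrow> y = 0"
  using R by (auto simp: partial_hom_def)

lemma partial_hom_0: "(0, 0) \<in> R" and partial_hom_1: "(1, 1) \<in> R"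
  using partial_hom_base[of 0] partial_hom_base[of 1] by simp_all

lemma partial_hom_minus: "(x, y) \<in> R \<Longrightarrow> (- x, - y) \<in> R"
  using partial_hom_mult[OF partial_hom_base[of "-1"], of x y] by simp

lemma partial_hom_diff: "(x, y) \<in> R \<Longrightarrow> (x', y') \<in> R \<Longrightarrow> (x - x', y - y') \<in> R"
  using partial_hom_add[OF _ partial_hom_minus, of x y x' y'] by simp

lemma partial_hom_unique:
  assumes "(x, y) \<in> R" "(x, y') \<in> R"
  shows "y = y'"
  using partial_hom_zeroD[of "y - y'"] partial_hom_diff[OF assms] by simp

lemma partial_hom_sum:
  "(\<And>i. i \<in> A \<Longrightarrow> (f i, g i) \<in> R) \<Longrightarrow> (sum f A, sum g A) \<in> R"
  by (induction A rule: infinite_finite_induct) (auto intro: partial_hom_0 partial_hom_add)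

lemma rel_poly_0: "rel_poly R 0 q \<longleftrightarrow> q = 0"
  using partial_hom_zeroD partial_hom_0 by (auto simp: rel_poly_def poly_eq_iff)

lemma rel_poly_to_ac: "rel_poly R (map_poly to_ac p) (map_poly to_ac p)"
  by (simp add: rel_poly_def coeff_map_poly partial_hom_base)

lemma rel_poly_add: "rel_poly R p q \<Longrightarrow> rel_poly R p' q' \<Longrightarrow> rel_poly R (p + p') (q + q')"
  and rel_poly_diff: "rel_poly R p q \<Longrightarrow> rel_poly R p' q' \<Longrightarrow> rel_poly R (p - p') (q - q')"
  and rel_poly_mult: "rel_poly R p q \<Longrightarrow> rel_poly R p' q' \<Longrightarrow> rel_poly R (p * p') (q * q')"
  by (auto simp: rel_poly_def coeff_mult
      intro!: partial_hom_add partial_hom_diff partial_hom_mult partial_hom_sum)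

lemma rel_poly_monom: "(a, b) \<in> R \<Longrightarrow> rel_poly R (Polynomial.monom a n) (Polynomial.monom b n)"
  by (auto simp: rel_poly_def partial_hom_0)

lemma partial_hom_poly:
  assumes "rel_poly R p q" "(x, y) \<in> R"
  shows "(poly p x, poly q y) \<in> R"
  using assms(1)
proof (induction p arbitrary: q)
  case 0
  then show ?case by (simp add: rel_poly_0 partial_hom_0)
next
  case (pCons a p)
  then show ?case
    by (cases q) (auto intro!: partial_hom_add partial_hom_mult assms(2))
qed

text \<open>An equation \<open>a + x * p(x) = 0\<close> with \<open>a \<noteq> 0\<close> gives
  \<open>- p(x) / a\<close> as the inverse of \<open>x\<close>; so the domain of \<open>R\<close>,
  being algebraic over the base field, is itself a field.\<close>

lemma partial_hom_inverse:
  assumes "(x, y) \<in> R" "x \<noteq> 0"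
  shows "(inverse x, inverse y) \<in> R"
proof -
  have "\<exists>z. (inverse x, z) \<in> R" if "p \<noteq> 0" "poly (map_poly to_ac p) x = 0" for p
    using that
  proof (induction p)
    case (pCons a p)
    then have root: "to_ac a + x * poly (map_poly to_ac p) x = 0"
      by (simp add: map_poly_pCons)
    show ?case
    proof (cases "a = 0")
      case True
      then show ?thesis using pCons root assms(2) by auto
    next
      case False
      have "inverse x = poly (map_poly to_ac p) x * to_ac (- inverse a)"
        using root False assms(2) by (simp add: field_simps eq_neg_iff_add_eq_0)
      then show ?thesis
        using partial_hom_mult[OF partial_hom_poly[OF rel_poly_to_ac assms(1)] partial_hom_base]
        by metis
    qed
  qed simp
  then obtain z where z: "(inverse x, z) \<in> R"
    using alg_closure_algebraic[of x] by metis
  have "(x * inverse x, y * z) \<in> R"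
    by (rule partial_hom_mult[OF assms(1) z])
  then have "1 = y * z"
    using assms(2) by (intro partial_hom_unique[OF partial_hom_1]) simp
  then have "z = inverse y"
    by (metis inverse_unique)
  with z show ?thesis by simp
qed

text \<open>\<open>m\<close> is the minimal polynomial of \<open>x\<close> over the domain of
  \<open>R\<close> and \<open>m'\<close> its image. Division by \<open>m\<close> is carried out on
  both components at once, which transfers divisibility to the images.\<close>

lemma partial_hom_minpoly:
  obtains m m' where "rel_poly R m m'" "Polynomial.lead_coeff m = 1"
    "Polynomial.degree m' = Polynomial.degree m" "poly m x = 0"
    "\<And>p q. rel_poly R p q \<Longrightarrow> poly p x = 0 \<Longrightarrow> m dvd p \<and> m' dvd q"
proof -
  define S where "S = {(p, q). rel_poly R p q \<and> p \<noteq> 0 \<and> poly p x = 0}"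
  have "\<exists>pq. pq \<in> S"
  proof -
    obtain p where "p \<noteq> 0" "poly (map_poly to_ac p) x = 0"
      using alg_closure_algebraic[of x] .
    then have "(map_poly to_ac p, map_poly to_ac p) \<in> S"
      by (simp add: S_def rel_poly_to_ac map_poly_eq_0_iff)
    then show ?thesis ..
  qed
  then obtain pq where pq: "pq \<in> S"
    "\<And>p'q'. p'q' \<in> S \<Longrightarrow> Polynomial.degree (fst pq) \<le> Polynomial.degree (fst p'q')"
    using ex_has_least_nat[of "\<lambda>pq. pq \<in> S" _ "\<lambda>pq. Polynomial.degree (fst pq)"] by blast
  obtain p0 q0 where p0: "pq = (p0, q0)" by fastforce
  define n where "n = Polynomial.degree p0"
  have S0: "rel_poly R p0 q0" "p0 \<noteq> 0" "poly p0 x = 0" using pq p0 by (auto simp: S_def)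
  have min: "p = 0" if "rel_poly R p q" "poly p x = 0" "Polynomial.degree p < n" for p q
    using pq(2)[of "(p, q)"] that by (force simp: S_def p0 n_def)
  define m where "m = Polynomial.monom (inverse (Polynomial.coeff p0 n)) 0 * p0"
  define m' where "m' = Polynomial.monom (inverse (Polynomial.coeff q0 n)) 0 * q0"
  have lc: "Polynomial.coeff p0 n \<noteq> 0" using S0 by (simp add: n_def)
  have rel: "rel_poly R m m'"
    unfolding m_def m'_def using S0 lc
    by (intro rel_poly_mult rel_poly_monom partial_hom_inverse) (auto simp: rel_poly_def)
  have deg: "Polynomial.degree m = n" and lcm: "Polynomial.coeff m n = 1"
    using lc by (simp_all add: m_def monom_0 n_def)
  have root: "poly m x = 0" using S0 by (simp add: m_def)
  have m'n: "Polynomial.coeff m' n = 1"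
    using rel lcm partial_hom_unique[OF _ partial_hom_1] by (metis rel_poly_def)
  have deg': "Polynomial.degree m' = n"
  proof (rule antisym)
    show "Polynomial.degree m' \<le> n"
      using rel deg partial_hom_zeroD by (intro degree_le) (metis coeff_eq_0 rel_poly_def)
    show "n \<le> Polynomial.degree m'" using m'n by (intro le_degree) simp
  qed
  have div: "m dvd p \<and> m' dvd q" if "rel_poly R p q" "poly p x = 0" for p q
    using that
  proof (induction "Polynomial.degree p" arbitrary: p q rule: less_induct)
    case less
    let ?d = "Polynomial.degree p"
    show ?case
    proof (cases "p = 0")
      case True
      then show ?thesis using less.prems by (simp add: rel_poly_0)
    next
      case False
      then have d: "n \<le> ?d" using min[OF less.prems] by force
      \<comment> \<open>One step of the division: the leading term of \<open>p\<close> is cancelled,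
        and \<open>q\<close> undergoes the corresponding operation.\<close>
      define s where "s = Polynomial.monom (Polynomial.coeff p ?d) (?d - n)"
      define s' where "s' = Polynomial.monom (Polynomial.coeff q ?d) (?d - n)"
      have rel': "rel_poly R (p - s * m) (q - s' * m')"
        using less.prems rel unfolding s_def s'_def
        by (intro rel_poly_diff rel_poly_mult rel_poly_monom) (auto simp: rel_poly_def)
      have root': "poly (p - s * m) x = 0" using less.prems root by simp
      have "m dvd p - s * m \<and> m' dvd q - s' * m'"
      proof (cases "p - s * m = 0")
        case True
        then show ?thesis using rel' by (simp add: rel_poly_0)
      next
        case nz: False
        have "Polynomial.degree (s * m) \<le> ?d"
          using d degree_mult_le[of s m] degree_monom_le[of "Polynomial.coeff p ?d" "?d - n"]
          by (simp add: s_def deg)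
        then have "Polynomial.degree (p - s * m) \<le> ?d"
          by (intro degree_diff_le) auto
        moreover have "Polynomial.coeff (p - s * m) ?d = 0"
          using d lcm by (simp add: s_def coeff_monom_mult)
        ultimately have "Polynomial.degree (p - s * m) < ?d"
          using nz by (metis leading_coeff_0_iff le_neq_implies_less)
        then show ?thesis by (rule less.hyps[OF _ rel' root'])
      qed
      then show ?thesis
        by (metis add.commute diff_add_cancel dvd_add dvd_triv_right)
    qed
  qed
  show ?thesis
    by (rule that[of m m']) (use rel deg deg' lcm root div in auto)
qed

text \<open>Sending \<open>p(x)\<close> to \<open>q(y)\<close> is well defined by the assumption,
  which is the condition above \<open>0\<close> in \<open>partial_hom\<close>.\<close>

lemma partial_hom_adjoin:
  assumes "\<And>p q. rel_poly R p q \<Longrightarrow> poly p x = 0 \<Longrightarrow> poly q y = 0"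
  shows "\<exists>R'. partial_hom R' \<and> R \<subseteq> R' \<and> (x, y) \<in> R'"
proof (intro exI conjI)
  let ?R' = "{(poly p x, poly q y) | p q. rel_poly R p q}"
  have const: "(a, b) \<in> ?R'" if "(a, b) \<in> R" for a b
  proof -
    have "rel_poly R [:a:] [:b:]" using that by (simp add: rel_poly_0)
    then show ?thesis by (intro CollectI exI[of _ "[:a:]"] exI[of _ "[:b:]"]) simp
  qed
  then show "R \<subseteq> ?R'" by auto
  have "rel_poly R [:0, 1:] [:0, 1:]"
    by (simp add: rel_poly_0 partial_hom_0 partial_hom_1)
  then show "(x, y) \<in> ?R'" by (intro CollectI exI[of _ "[:0, 1:]"]) simp
  show "partial_hom ?R'"
    unfolding partial_hom_def
  proof (intro conjI allI impI)
    show "(to_ac c, to_ac c) \<in> ?R'" for c by (intro const partial_hom_base)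
  next
    fix a b a' b'
    assume "(a, b) \<in> ?R'" "(a', b') \<in> ?R'"
    then obtain p q p' q' where "rel_poly R p q" "rel_poly R p' q'"
      and ab: "a = poly p x" "b = poly q y" "a' = poly p' x" "b' = poly q' y" by blast
    then have "rel_poly R (p + p') (q + q')" "rel_poly R (p * p') (q * q')"
      by (auto intro: rel_poly_add rel_poly_mult)
    then have "(poly (p + p') x, poly (q + q') y) \<in> ?R'" "(poly (p * p') x, poly (q * q') y) \<in> ?R'"
      by blast+
    then show "(a + a', b + b') \<in> ?R'" "(a * a', b * b') \<in> ?R'"
      by (simp_all add: ab)
  next
    show "b = 0" if "(0, b) \<in> ?R'" for b
      using that assms by force
  qed
qed

end

text \<open>Zorn's lemma gives a maximal graph \<open>N\<close>. It is total, since any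
  \<open>x\<close> can be adjoined by sending it to a root of the image of its minimal
  polynomial.\<close>

theorem partial_hom_extend:
  fixes R :: "('b::field alg_closure \<times> 'b alg_closure) set"
  assumes "partial_hom R"
  obtains \<sigma> where "ac_hom \<sigma>" "\<And>x y. (x, y) \<in> R \<Longrightarrow> \<sigma> x = y"
proof -
  define A where "A = {R'. partial_hom R' \<and> R \<subseteq> R'}"
  have "\<exists>N\<in>A. \<forall>Z\<in>A. N \<subseteq> Z \<longrightarrow> Z = N"
  proof (rule subset_Zorn_nonempty)
    show "A \<noteq> {}" using assms by (auto simp: A_def)
    fix C assume C: "C \<noteq> {}" "subset.chain A C"
    then have ph: "partial_hom Z" "R \<subseteq> Z" if "Z \<in> C" for Z
      using that by (auto simp: subset_chain_def A_def)
    have dir: "\<exists>Z\<in>C. X1 \<subseteq> Z \<and> X2 \<subseteq> Z" if "X1 \<in> C" "X2 \<in> C" for X1 X2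
      using C(2) that unfolding subset_chain_def by (metis subset_refl)
    have "partial_hom (\<Union>C)"
      unfolding partial_hom_def
    proof (intro conjI allI impI)
      show "(to_ac c, to_ac c) \<in> \<Union>C" for c
        using C(1) ph(1) partial_hom_base by blast
      show "b = 0" if "(0, b) \<in> \<Union>C" for b
        using that ph(1) partial_hom_zeroD by blast
      fix a b a' b'
      assume "(a, b) \<in> \<Union>C" "(a', b') \<in> \<Union>C"
      then obtain Z where "Z \<in> C" "(a, b) \<in> Z" "(a', b') \<in> Z"
        using dir by blast
      then show "(a + a', b + b') \<in> \<Union>C" "(a * a', b * b') \<in> \<Union>C"
        using partial_hom_add[OF ph(1)] partial_hom_mult[OF ph(1)] by blast+
    qed
    then show "\<Union>C \<in> A" using C(1) ph(2) by (auto simp: A_def)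
  qed
  then obtain N where N: "partial_hom N" "R \<subseteq> N"
    and max: "\<And>Z. partial_hom Z \<Longrightarrow> N \<subseteq> Z \<Longrightarrow> Z = N"
    by (auto simp: A_def)
  have total: "\<exists>y. (x, y) \<in> N" for x
  proof -
    obtain m m' where m: "rel_poly N m m'" "Polynomial.lead_coeff m = 1"
      "Polynomial.degree m' = Polynomial.degree m" "poly m x = 0"
      "\<And>p q. rel_poly N p q \<Longrightarrow> poly p x = 0 \<Longrightarrow> m dvd p \<and> m' dvd q"
      using partial_hom_minpoly[OF N(1), of x] by blast
    have "Polynomial.degree m \<noteq> 0"
    proof
      assume "Polynomial.degree m = 0"
      then have "m = 1" using m(2) by (auto elim!: degree_eq_zeroE simp: one_pCons)
      then show False using m(4) by simp
    qed
    then obtain y where "poly m' y = 0"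
      using alg_closed_imp_poly_has_root[of m'] m(3) by auto
    then have "poly q y = 0" if "rel_poly N p q" "poly p x = 0" for p q
      using m(5)[OF that] by auto
    then show ?thesis
      using partial_hom_adjoin[OF N(1), of x y] max by blast
  qed
  define \<sigma> where "\<sigma> x = (SOME y. (x, y) \<in> N)" for x
  have \<sigma>: "(x, \<sigma> x) \<in> N" for x unfolding \<sigma>_def by (rule someI_ex[OF total])
  have \<sigma>_eq: "\<sigma> x = y" if "(x, y) \<in> N" for x y
    using partial_hom_unique[OF N(1) \<sigma> that] .
  have "ac_hom \<sigma>"
    unfolding ac_hom_def
    by (auto intro!: \<sigma>_eq partial_hom_base[OF N(1)] partial_hom_add[OF N(1)] partial_hom_mult[OF N(1)] \<sigma>)
  then show ?thesis using that \<sigma>_eq N(2) by blast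
qed

text \<open>\<open>x\<close> is a simple root of \<open>p\<close>, hence of its minimal polynomial
  \<open>m\<close> over \<open>F\<close>. As \<open>m\<close> is not linear, it has a root
  \<open>y \<noteq> x\<close>, and \<open>x\<close> can be sent there.\<close>

lemma ac_hom_moving:
  fixes x :: "'b::field alg_closure"
  assumes F: "range to_ac \<subseteq> F" "\<And>a b. a \<in> F \<Longrightarrow> b \<in> F \<Longrightarrow> a + b \<in> F"
    "\<And>a b. a \<in> F \<Longrightarrow> b \<in> F \<Longrightarrow> a * b \<in> F"
    and p: "\<And>i. Polynomial.coeff p i \<in> F" "poly p x = 0" "poly (pderiv p) x \<noteq> 0"
    and x: "x \<notin> F"
  obtains \<sigma> where "ac_hom \<sigma>" "\<And>c. c \<in> F \<Longrightarrow> \<sigma> c = c" "\<sigma> x \<noteq> x"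
proof -
  define R where "R = {(c, c) | c. c \<in> F}"
  have R: "partial_hom R" using F by (auto simp: partial_hom_def R_def)
  obtain m m' where m: "rel_poly R m m'" "Polynomial.lead_coeff m = 1"
      "Polynomial.degree m' = Polynomial.degree m" "poly m x = 0"
      "\<And>p q. rel_poly R p q \<Longrightarrow> poly p x = 0 \<Longrightarrow> m dvd p \<and> m' dvd q"
    using partial_hom_minpoly[OF R, of x] by blast
  have "m' = m" using m(1) by (auto simp: rel_poly_def R_def poly_eq_iff)
  have "rel_poly R p p" using p(1) by (auto simp: rel_poly_def R_def)
  then obtain s where s: "p = m * s" using m(5) p(2) by blast
  have m'x: "poly (pderiv m) x \<noteq> 0"
    using p(3) m(4) by (auto simp: s pderiv_mult)
  obtain n where n: "m = [:- x, 1:] * n"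
    using m(4) by (auto simp: poly_eq_0_iff_dvd)
  have "poly n x \<noteq> 0"
    using m'x unfolding n pderiv_mult by (simp add: pderiv_pCons)
  \<comment> \<open>For constant \<open>n\<close> the polynomial \<open>m\<close> would be
    \<open>X - x\<close>, and \<open>x\<close> would lie in \<open>F\<close>.\<close>
  have "Polynomial.degree n \<noteq> 0"
  proof
    assume "Polynomial.degree n = 0"
    then obtain c where c: "n = [:c:]" by (elim degree_eq_zeroE)
    have "c \<noteq> 0" using c \<open>poly n x \<noteq> 0\<close> by simp
    then have "c = 1" using m(2) by (simp add: n c)
    then have "Polynomial.coeff m 0 = - x" by (simp add: n c)
    moreover have "(Polynomial.coeff m 0, Polynomial.coeff m' 0) \<in> R"
      using m(1) by (simp add: rel_poly_def)
    ultimately have "- x \<in> F" by (simp add: R_def)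
    then have "to_ac (- 1) * (- x) \<in> F" using F by blast
    then show False using x by simp
  qed
  then obtain y where y: "poly n y = 0" using alg_closed_imp_poly_has_root[of n] by auto
  have "y \<noteq> x" using y \<open>poly n x \<noteq> 0\<close> by auto
  have "poly q y = 0" if "rel_poly R p q" "poly p x = 0" for p q
    using m(5)[OF that] y by (auto simp: \<open>m' = m\<close> n)
  then obtain R' where R': "partial_hom R'" "R \<subseteq> R'" "(x, y) \<in> R'"
    using partial_hom_adjoin[OF R] by metis
  obtain \<sigma> where "ac_hom \<sigma>" "\<And>a b. (a, b) \<in> R' \<Longrightarrow> \<sigma> a = b"
    using partial_hom_extend[OF R'(1)] by blast
  then show ?thesis
    using R' \<open>y \<noteq> x\<close> by (intro that[of \<sigma>]) (auto simp: R_def)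
qed

section \<open>The Carlitz polynomials\<close>

context
  fixes \<phi> :: "'b::comm_ring_1 \<Rightarrow> 'c::comm_ring_1"
  assumes \<phi>: "\<phi> 0 = 0" "\<And>x y. \<phi> (x + y) = \<phi> x + \<phi> y" "\<And>x y. \<phi> (x * y) = \<phi> x * \<phi> y"
begin

lemma poly_map_poly_pCons: "poly (map_poly \<phi> (pCons a p)) x = \<phi> a + x * poly (map_poly \<phi> p) x"
  using \<phi>(1) by (simp add: map_poly_pCons)

lemma poly_map_poly_add:
  "poly (map_poly \<phi> (p + q)) x = poly (map_poly \<phi> p) x + poly (map_poly \<phi> q) x"
proof -
  have "map_poly \<phi> (p + q) = map_poly \<phi> p + map_poly \<phi> q"
    by (simp add: poly_eq_iff coeff_map_poly \<phi>)
  then show ?thesis by simp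
qed

lemma poly_map_poly_smult:
  "poly (map_poly \<phi> (Polynomial.smult a p)) x = \<phi> a * poly (map_poly \<phi> p) x"
  by (subst map_poly_smult) (simp_all add: \<phi>)

lemma poly_map_poly_mult:
  "poly (map_poly \<phi> (p * q)) x = poly (map_poly \<phi> p) x * poly (map_poly \<phi> q) x"
  by (induction p)
     (simp_all add: poly_map_poly_add poly_map_poly_smult poly_map_poly_pCons \<phi> algebra_simps)

lemma poly_map_poly_diff:
  "poly (map_poly \<phi> (p - q)) x = poly (map_poly \<phi> p) x - poly (map_poly \<phi> q) x"
  using poly_map_poly_add[of "p - q" q x] by (simp add: algebra_simps)

end

text \<open>The coefficients stay in \<open>A\<close>, not in \<open>k\<close>, so that congruences
  modulo a prime of \<open>A\<close> make sense for the values.\<close>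

definition eval_A :: "'a::field poly poly \<Rightarrow> 'a kbar \<Rightarrow> 'a kbar"
  where "eval_A h x = poly (map_poly of_A h) x"

lemma of_A_eq_0_iff [simp]: "of_A f = 0 \<longleftrightarrow> f = 0"
  by (simp add: of_A_def)

lemma of_A_diff [simp]: "of_A (f - g) = of_A f - of_A g"
  by (simp add: of_A_def)

lemma of_A_eq_iff [simp]: "of_A f = of_A g \<longleftrightarrow> f = g"
  by (simp add: of_A_def)

lemma eval_A_simps [simp]:
  "eval_A 0 x = 0" "eval_A 1 x = 1" "eval_A (pCons a h) x = of_A a + x * eval_A h x"
  "eval_A (h + h') x = eval_A h x + eval_A h' x" "eval_A (h - h') x = eval_A h x - eval_A h' x"
  "eval_A (h * h') x = eval_A h x * eval_A h' x"
  "eval_A (Polynomial.smult a h) x = of_A a * eval_A h x"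
  by (simp_all add: eval_A_def poly_map_poly_pCons poly_map_poly_add poly_map_poly_diff
      poly_map_poly_mult poly_map_poly_smult)

lemma eval_A_power [simp]: "eval_A (h ^ n) x = eval_A h x ^ n"
  by (induction n) simp_all

lemma eval_A_sum: "eval_A (sum h I) x = (\<Sum>i\<in>I. eval_A (h i) x)"
  by (induction I rule: infinite_finite_induct) simp_all

lemma eval_A_monom [simp]: "eval_A (Polynomial.monom a n) x = of_A a * x ^ n"
  by (simp add: eval_A_def map_poly_monom poly_monom)

lemma eval_A_fract_poly: "poly (map_poly to_ac (fract_poly h)) x = eval_A h x"
  by (simp add: eval_A_def map_poly_map_poly o_def of_A_def[abs_def])

lemma map_poly_of_A_pderiv: "map_poly of_A (pderiv h) = pderiv (map_poly of_A h)"
  by (simp add: poly_eq_iff coeff_map_poly coeff_pderiv del: of_nat_Suc)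

section \<open>Coefficients of the Carlitz polynomials\<close>

lemma card_finite_field_gt_1: "CARD('a::finite_field) > 1"
  using card_mono[of "UNIV :: 'a set" "{0, 1}"] by simp

lemma frobenius_power_add:
  fixes f g :: "'a::finite_field poly"
  shows "(f + g) ^ (CARD('a) ^ n) = f ^ (CARD('a) ^ n) + g ^ (CARD('a) ^ n)"
proof (induction n)
  case (Suc n)
  have *: "(f + g) ^ CARD('a) = f ^ CARD('a) + g ^ CARD('a)" for f g :: "'a poly"
    using frobenius_add[of "of_A f" "of_A g"] unfolding of_A_eq_iff[symmetric] by simp
  have "h ^ (CARD('a) ^ Suc n) = (h ^ (CARD('a) ^ n)) ^ CARD('a)" for h :: "'a poly"
    by (simp only: power_Suc2 power_mult)
  then show ?case using Suc * by simp
qed simp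

lemma const_poly_frobenius: "[:a::'a::finite_field:] ^ (CARD('a) ^ n) = [:a:]"
proof (induction n)
  case (Suc n)
  have "[:a:] ^ CARD('a) = [:a:]"
    using of_A_const_power_card[of a] by (simp flip: of_A_power)
  with Suc show ?case by (simp add: power_mult mult.commute)
qed simp

text \<open>The coefficient of \<open>X^(q^i)\<close> in \<open>C_f(X)\<close>; the fold implements
  \<open>C_(a + T f)(X) = a X + C_f(X^q + T X)\<close>.\<close>

definition carlitz_coeff :: "'a::field poly \<Rightarrow> nat \<Rightarrow> 'a poly"
  where "carlitz_coeff f = fold_coeffs (\<lambda>a c i. (if i = 0 then [:a:] else c (i - 1)) +
    [:0, 1:] ^ (CARD('a) ^ i) * c i) f (\<lambda>_. 0)"

lemma carlitz_coeff_0 [simp]: "carlitz_coeff 0 i = 0"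
  by (simp add: carlitz_coeff_def)

lemma carlitz_coeff_pCons:
  fixes f :: "'a::field poly"
  shows "carlitz_coeff (pCons a f) i =
    (if i = 0 then [:a:] else carlitz_coeff f (i - 1)) +
    [:0, 1:] ^ (CARD('a) ^ i) * carlitz_coeff f i"
proof (cases "a = 0 \<and> f = 0")
  case False
  then show ?thesis
    by (cases "f = 0") (auto simp: carlitz_coeff_def
        fold_coeffs_pCons_coeff_not_0_eq fold_coeffs_pCons_not_0_0_eq)
qed auto

lemma carlitz_coeff_at_0: "carlitz_coeff f 0 = f"
  by (induction f) (simp_all add: carlitz_coeff_pCons)

lemma carlitz_coeff_eq_0: "Polynomial.degree f < i \<Longrightarrow> carlitz_coeff f i = 0"
proof (induction f arbitrary: i)
  case (pCons a f)
  then show ?case by (auto simp: carlitz_coeff_pCons split: if_splits)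
qed simp

lemma carlitz_coeff_degree:
  "carlitz_coeff f (Polynomial.degree f) = [:Polynomial.lead_coeff f:]"
proof (induction f)
  case (pCons a f)
  then show ?case by (cases "f = 0") (auto simp: carlitz_coeff_pCons carlitz_coeff_eq_0)
qed simp

text \<open>The recursion expresses that \<open>C\<^sub>f\<close> commutes with \<open>C\<^sub>T\<close>.\<close>

lemma carlitz_coeff_Suc:
  fixes f :: "'a::finite_field poly"
  shows "carlitz_coeff f (Suc i) * ([:0, 1:] ^ (CARD('a) ^ Suc i) - [:0, 1:]) =
    carlitz_coeff f i ^ CARD('a) - carlitz_coeff f i"
proof (induction f arbitrary: i)
  case 0
  then show ?case using card_finite_field_gt_1[where 'a = 'a] by (simp add: zero_power)
next
  case (pCons a f)
  let ?q = "CARD('a)" and ?T = "[:0, 1::'a:]" and ?c = "carlitz_coeff f"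
  define b where "b = (if i = 0 then [:a:] else ?c (i - 1))"
  have frob: "(g + h) ^ ?q = g ^ ?q + h ^ ?q" for g h :: "'a poly"
    using frobenius_power_add[of g h 1] by simp
  \<comment> \<open>For \<open>i > 0\<close> this is the induction hypothesis at
    \<open>i - 1\<close>; for \<open>i = 0\<close> it says \<open>a^q = a\<close>.\<close>
  have "?T ^ (?q ^ i) * ?c i + b = ?T * ?c i + b ^ ?q"
  proof (cases i)
    case 0
    then show ?thesis using const_poly_frobenius[of a 1] by (simp add: b_def)
  next
    case (Suc j)
    then show ?thesis using pCons.IH[of j] by (simp add: b_def algebra_simps)
  qed
  then have "(b + ?T ^ (?q ^ i) * ?c i) ^ ?q - (b + ?T ^ (?q ^ i) * ?c i) =
      ?T ^ (?q ^ Suc i) * ?c i ^ ?q - ?T * ?c i"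
    unfolding frob by (simp add: power_mult_distrib algebra_simps flip: power_mult)
  moreover have "(?c i + ?T ^ (?q ^ Suc i) * ?c (Suc i)) * (?T ^ (?q ^ Suc i) - ?T) =
      ?T ^ (?q ^ Suc i) * ?c i ^ ?q - ?T * ?c i"
    using arg_cong[OF pCons.IH[of i], of "\<lambda>x. ?T ^ (?q ^ Suc i) * x"] by (simp add: algebra_simps)
  ultimately show ?case by (simp add: carlitz_coeff_pCons b_def)
qed

definition carlitz_poly :: "'a::field poly \<Rightarrow> 'a poly poly"
  where "carlitz_poly f =
    (\<Sum>i\<le>Polynomial.degree f. Polynomial.monom (carlitz_coeff f i) (CARD('a) ^ i))"

lemma carlitz_sum_coeff:
  fixes f :: "'a::finite_field poly"
  assumes "Polynomial.degree f \<le> n"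
  shows "carlitz f x = (\<Sum>i\<le>n. of_A (carlitz_coeff f i) * x ^ (CARD('a) ^ i))"
  using assms
proof (induction f arbitrary: n x)
  case 0
  then show ?case by simp
next
  case (pCons a f)
  let ?q = "CARD('a)" and ?T = "[:0, 1::'a:]"
  show ?case
  proof (cases "f = 0")
    case True
    then show ?thesis
      by (subst sum.mono_neutral_right[of _ "{0}"]) (auto simp: carlitz_coeff_pCons carlitz_pCons)
  next
    case False
    then obtain m where m: "n = Suc m" "Polynomial.degree f \<le> m"
      using pCons.prems by (cases n) auto
    have frob: "(x ^ ?q + y) ^ (?q ^ i) = x ^ (?q ^ Suc i) + y ^ (?q ^ i)" for x y :: "'a kbar" and i
      by (induction i arbitrary: x y)
         (simp_all add: frobenius_add power_mult flip: power_mult_distrib)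
    have "carlitz f (carlitz_T x) =
        (\<Sum>i\<le>m. of_A (carlitz_coeff f i) * (x ^ ?q + of_A ?T * x) ^ (?q ^ i))"
      using pCons.IH[OF m(2)] by (simp add: carlitz_T_def)
    also have "\<dots> = (\<Sum>i\<le>m. of_A (carlitz_coeff f i) * x ^ (?q ^ Suc i)) +
        (\<Sum>i\<le>m. of_A (?T ^ (?q ^ i) * carlitz_coeff f i) * x ^ (?q ^ i))"
      unfolding frob by (simp add: algebra_simps power_mult_distrib sum.distrib)
    \<comment> \<open>The added term at \<open>Suc m\<close> is zero, as \<open>m\<close> bounds the
      degree of \<open>f\<close>; the range now matches that of the shifted sum.\<close>
    also have "(\<Sum>i\<le>m. of_A (?T ^ (?q ^ i) * carlitz_coeff f i) * x ^ (?q ^ i)) =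
        (\<Sum>i\<le>Suc m. of_A (?T ^ (?q ^ i) * carlitz_coeff f i) * x ^ (?q ^ i))"
      using m by (simp add: carlitz_coeff_eq_0)
    finally have 1: "carlitz f (carlitz_T x) =
        (\<Sum>i\<le>m. of_A (carlitz_coeff f i) * x ^ (?q ^ Suc i)) +
        (\<Sum>i\<le>Suc m. of_A (?T ^ (?q ^ i) * carlitz_coeff f i) * x ^ (?q ^ i))" .
    have 2: "of_A [:a:] * x + (\<Sum>i\<le>m. of_A (carlitz_coeff f i) * x ^ (?q ^ Suc i)) =
        (\<Sum>i\<le>Suc m. of_A (if i = 0 then [:a:] else carlitz_coeff f (i - 1)) * x ^ (?q ^ i))"
      by (subst sum.atMost_Suc_shift) simp
    show ?thesis
      unfolding carlitz_pCons 1 add.assoc[symmetric] 2 m(1) carlitz_coeff_pCons of_A_simps(3)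
        distrib_right sum.distrib ..
  qed
qed

lemma eval_carlitz_poly: "eval_A (carlitz_poly f) x = carlitz f (x :: 'a::finite_field kbar)"
  by (simp add: carlitz_poly_def eval_A_sum carlitz_sum_coeff[OF order.refl])

text \<open>Since \<open>q = 0\<close> in \<open>A\<close>, the derivative of \<open>X^(q^i)\<close>
  vanishes for \<open>i > 0\<close> and only the linear term contributes. This is what makes
  \<open>C_f(X) - a\<close> separable for \<open>f \<noteq> 0\<close>.\<close>

lemma pderiv_carlitz_poly:
  fixes f :: "'a::finite_field poly"
  shows "pderiv (carlitz_poly f) = [:f:]"
proof -
  \<comment> \<open>\<open>q\<close> is the binomial coefficient \<open>q choose 1\<close>.\<close>
  have q: "of_nat CARD('a) = (0 :: 'a poly)"
    using card_choose_eq_0[of 1, where 'a = 'a] card_finite_field_gt_1[where 'a = 'a]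
    by (simp add: of_nat_poly)
  have "pderiv (carlitz_poly f) =
      (\<Sum>i\<le>Polynomial.degree f. pderiv (Polynomial.monom (carlitz_coeff f i) (CARD('a) ^ i)))"
    unfolding carlitz_poly_def
    using higher_pderiv_sum[of 1] by simp
  also have "\<dots> = (\<Sum>i\<in>{0}. pderiv (Polynomial.monom (carlitz_coeff f i) (CARD('a) ^ i)))"
    by (rule sum.mono_neutral_right) (auto simp: pderiv_monom q)
  also have "\<dots> = [:f:]"
    by (simp add: pderiv_monom carlitz_coeff_at_0 monom_0)
  finally show ?thesis .
qed

lemma degree_carlitz_poly:
  fixes f :: "'a::finite_field poly"
  assumes "f \<noteq> 0"
  shows "Polynomial.degree (carlitz_poly f) = CARD('a) ^ Polynomial.degree f" (is ?deg)
    and "Polynomial.lead_coeff (carlitz_poly f) = [:Polynomial.lead_coeff f:]"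
proof -
  let ?q = "CARD('a)" and ?d = "Polynomial.degree f"
  have q: "?q > 1" by (rule card_finite_field_gt_1)
  have coeff: "Polynomial.coeff (carlitz_poly f) (?q ^ ?d) = [:Polynomial.lead_coeff f:]"
    using q by (simp add: carlitz_poly_def coeff_sum power_inject_exp
        carlitz_coeff_degree cong: if_cong)
  have "Polynomial.degree (carlitz_poly f) \<le> ?q ^ ?d"
    unfolding carlitz_poly_def using q
    by (intro degree_sum_le) (auto intro!: order.trans[OF degree_monom_le] power_increasing)
  moreover have "?q ^ ?d \<le> Polynomial.degree (carlitz_poly f)"
    using assms by (intro le_degree) (simp add: coeff)
  ultimately show ?deg by simp
  then show "Polynomial.lead_coeff (carlitz_poly f) = [:Polynomial.lead_coeff f:]"
    using coeff by simp
qed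

section \<open>Reduction modulo a prime of \<open>A\<close>\<close>

lemma card_poly_bounded:
  "finite {h :: 'a::{finite,zero} poly. \<forall>i\<ge>n. Polynomial.coeff h i = 0} \<and>
   card {h :: 'a poly. \<forall>i\<ge>n. Polynomial.coeff h i = 0} = CARD('a) ^ n"
proof (induction n)
  case 0
  have "{h :: 'a poly. \<forall>i\<ge>0. Polynomial.coeff h i = 0} = {0}"
    by (auto simp: poly_eq_iff)
  then show ?case by simp
next
  case (Suc n)
  let ?S = "\<lambda>n. {h :: 'a poly. \<forall>i\<ge>n. Polynomial.coeff h i = 0}"
  have eq: "?S (Suc n) = (\<lambda>(a, h). pCons a h) ` (UNIV \<times> ?S n)"
  proof (intro Set.set_eqI iffI)
    fix h assume "h \<in> ?S (Suc n)"
    moreover obtain a h' where "h = pCons a h'" by (cases h)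
    ultimately show "h \<in> (\<lambda>(a, h). pCons a h) ` (UNIV \<times> ?S n)" by force
  qed (auto simp: coeff_pCons split: nat.splits)
  have "inj_on (\<lambda>(a, h :: 'a poly). pCons a h) (UNIV \<times> ?S n)"
    by (auto simp: inj_on_def)
  then show ?case
    unfolding eq using Suc by (simp add: card_image card_cartesian_product)
qed

text \<open>The power \<open>q^n\<close> is additive, multiplicative and trivial on constants, so
  \<open>h(T)^(q^n) = h(T^(q^n))\<close>, which is congruent to \<open>h(T)\<close> modulo
  \<open>P\<close>.\<close>

lemma dvd_frobenius_diff:
  fixes P h :: "'a::finite_field poly"
  assumes "P dvd [:0, 1:] ^ (CARD('a) ^ n) - [:0, 1:]"
  shows "P dvd h ^ (CARD('a) ^ n) - h"
proof (induction h)
  case 0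
  then show ?case using card_finite_field_gt_1[where 'a = 'a] by (simp add: zero_power)
next
  case (pCons a h)
  let ?Q = "CARD('a) ^ n" and ?T = "[:0, 1::'a:]"
  have eq: "pCons a h = [:a:] + ?T * h" by simp
  have "pCons a h ^ ?Q - pCons a h = (?T ^ ?Q - ?T) * h ^ ?Q + ?T * (h ^ ?Q - h)"
    unfolding eq frobenius_power_add const_poly_frobenius power_mult_distrib
    by (simp only: algebra_simps)
  then show ?case
    using dvd_add[OF dvd_mult2[OF assms] dvd_mult[OF pCons.IH]] by metis
qed

lemma irreducible_poly_coprime:
  fixes P h :: "'a::field_gcd poly"
  assumes "Factorial_Ring.irreducible P" "\<not> P dvd h"
  shows "coprime P h"
  using assms by (intro prime_elem_imp_coprime irreducible_imp_prime_elem) auto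

text \<open>
  For a root \<open>\<theta>\<close> of \<open>P\<close>, the \<open>q\<^bsup>deg P\<^esup>\<close> elements \<open>h(\<theta>)\<close> with \<open>deg h < deg P\<close> are distinct roots of
  a polynomial of degree \<open>q\<^bsup>j\<^esup>\<close>.
\<close>

lemma degree_le_of_dvd_frobenius:
  fixes P :: "'a::{finite_field,field_gcd} poly"
  assumes P: "Factorial_Ring.irreducible P" and j: "j > 0" and dvd: "P dvd [:0, 1:] ^ (CARD('a) ^ j) - [:0, 1:]"
  shows "Polynomial.degree P \<le> j"
proof -
  let ?d = "Polynomial.degree P" and ?q = "CARD('a)"
  have "P \<noteq> 0" "\<not> P dvd 1" using P by (auto simp: Factorial_Ring.irreducible_def)
  then have d: "?d > 0" by (simp add: is_unit_iff_degree)
  have q: "?q > 1" by (rule card_finite_field_gt_1)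
  have "Polynomial.degree (map_poly to_ac P) = ?d" by (simp add: degree_map_poly)
  then obtain \<theta> where \<theta>: "poly (map_poly to_ac P) \<theta> = 0"
    using alg_closed_imp_poly_has_root[of "map_poly to_ac P"] d by auto
  define \<phi> where "\<phi> h = poly (map_poly to_ac h) \<theta>" for h
  have \<phi>: "\<phi> 1 = 1" "\<phi> (g + h) = \<phi> g + \<phi> h" "\<phi> (g - h) = \<phi> g - \<phi> h" "\<phi> (g * h) = \<phi> g * \<phi> h" for g h
    by (simp_all add: \<phi>_def poly_map_poly_add poly_map_poly_diff poly_map_poly_mult)
  have \<phi>_power: "\<phi> (h ^ n) = \<phi> h ^ n" for h n by (induction n) (simp_all add: \<phi>)
  have \<phi>_dvd: "\<phi> h = 0" if "P dvd h" for h
    using that \<theta> by (auto simp: \<phi> \<phi>_def elim!: dvdE simp: poly_map_poly_mult)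
  let ?S = "{h :: 'a poly. \<forall>i\<ge>?d. Polynomial.coeff h i = 0}"
  have "inj_on \<phi> ?S"
  proof (rule inj_onI, rule ccontr)
    fix g h assume gh: "g \<in> ?S" "h \<in> ?S" "\<phi> g = \<phi> h" "g \<noteq> h"
    have "Polynomial.degree (g - h) < ?d"
      using gh d by (intro degree_lessI) auto
    then have "\<not> P dvd g - h"
      using gh by (meson dvd_imp_degree_le eq_iff_diff_eq_0 leD)
    then have "coprime P (g - h)" by (rule irreducible_poly_coprime[OF P])
    then obtain u v where uv: "u * P + v * (g - h) = 1"
      using bezout_coefficients_fst_snd[of P "g - h"] by (metis coprime_imp_gcd_eq_1)
    have "\<phi> (u * P + v * (g - h)) = 0"
      using gh \<phi>_dvd[of P] by (simp add: \<phi>)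
    then show False by (simp add: uv \<phi>)
  qed
  moreover have "\<phi> ` ?S \<subseteq> {x. poly (Polynomial.monom 1 (?q ^ j) + [:0, - 1:]) x = 0}"
  proof (rule image_subsetI, rule CollectI)
    fix h
    have "\<phi> (h ^ (?q ^ j) - h) = 0"
      by (rule \<phi>_dvd[OF dvd_frobenius_diff[OF dvd]])
    then show "poly (Polynomial.monom 1 (?q ^ j) + [:0, - 1:]) (\<phi> h) = 0"
      by (simp add: \<phi> \<phi>_power poly_monom)
  qed
  moreover have deg: "Polynomial.degree (Polynomial.monom 1 (?q ^ j) + [:0, - 1:] :: 'a alg_closure poly) = ?q ^ j"
    using one_less_power[OF q j] by (subst degree_add_eq_left) (auto simp: degree_monom_eq)
  moreover from this have nz: "Polynomial.monom 1 (?q ^ j) + [:0, - 1:] \<noteq> (0 :: 'a alg_closure poly)"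
    using q by (metis degree_0 not_one_less_zero power_eq_0_iff)
  ultimately have "card ?S \<le> ?q ^ j"
    using card_inj_on_le[OF _ _ poly_roots_finite[OF nz], of \<phi> ?S] card_poly_roots_bound[OF nz]
    by simp
  then have "?q ^ ?d \<le> ?q ^ j" using card_poly_bounded[of ?d, where 'a = 'a] by simp
  then show ?thesis using q by (simp add: power_increasing_iff)
qed

text \<open>Starting from \<open>c_0 = P\<close>, the recursion for the coefficients of
  \<open>C_P\<close> carries divisibility by \<open>P\<close> from \<open>c_i\<close> to
  \<open>c_(i+1)\<close>, because \<open>P\<close> does not divide \<open>T^(q^(i+1)) - T\<close>
  while \<open>i + 1 < d\<close>. So \<open>C_P(X)\<close> is congruent to \<open>X^(q^d)\<close>
  modulo \<open>P\<close>.\<close>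

lemma carlitz_poly_irreducible:
  fixes P :: "'a::{finite_field,field_gcd} poly"
  assumes P: "Factorial_Ring.irreducible P" "Polynomial.lead_coeff P = 1"
  defines "d \<equiv> Polynomial.degree P"
  shows "P dvd [:0, 1:] ^ (CARD('a) ^ d) - [:0, 1:]"
    and "\<exists>h. \<forall>x. carlitz P x = x ^ (CARD('a) ^ d) + of_A P * eval_A h x"
proof -
  let ?q = "CARD('a)"
  have "P \<noteq> 0" "\<not> P dvd 1" using P by (auto simp: Factorial_Ring.irreducible_def)
  then have d: "d > 0" by (simp add: is_unit_iff_degree d_def)
  have prime: "prime_elem P" using P(1) by (rule irreducible_imp_prime_elem)
  have dvd: "P dvd carlitz_coeff P i" if "i < d" for i
    using that
  proof (induction i)
    case 0
    then show ?case by (simp add: carlitz_coeff_at_0)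
  next
    case (Suc i)
    have "P dvd carlitz_coeff P i ^ ?q - carlitz_coeff P i"
      using Suc by (intro dvd_diff dvd_power_le[of P, where n = 1, simplified]) auto
    then have "P dvd carlitz_coeff P (Suc i) * ([:0, 1:] ^ (?q ^ Suc i) - [:0, 1:])"
      by (simp only: carlitz_coeff_Suc)
    moreover have "\<not> P dvd [:0, 1:] ^ (?q ^ Suc i) - [:0, 1:]"
      using degree_le_of_dvd_frobenius[OF P(1), of "Suc i"] Suc.prems by (auto simp: d_def)
    ultimately show ?case using prime by (simp add: prime_elem_dvd_mult_iff)
  qed
  have top: "carlitz_coeff P d = 1"
    using carlitz_coeff_degree[of P] P(2) by (simp add: d_def one_pCons)
  obtain e where e: "d = Suc e" using d by (cases d) auto
  \<comment> \<open>As \<open>c_d = 1\<close>, the recursion at \<open>d - 1\<close> reads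
    \<open>T^(q^d) - T = c_(d-1)^q - c_(d-1)\<close>.\<close>
  have "P dvd carlitz_coeff P e ^ ?q - carlitz_coeff P e"
    using dvd[of e] e by (intro dvd_diff dvd_power_le[of P, where n = 1, simplified]) auto
  then show "P dvd [:0, 1:] ^ (?q ^ d) - [:0, 1:]"
    using carlitz_coeff_Suc[of P e] top by (simp only: e) simp
  define h where "h = (\<Sum>i<d. Polynomial.monom (carlitz_coeff P i div P) (?q ^ i))"
  have "carlitz P x = x ^ (?q ^ d) + of_A P * eval_A h x" for x
  proof -
    have "of_A P * eval_A h x = (\<Sum>i<d. of_A (carlitz_coeff P i) * x ^ (?q ^ i))"
      unfolding h_def eval_A_sum sum_distrib_left
      using dvd by (intro sum.cong) (simp_all add: mult.assoc[symmetric] flip: of_A_simps(4))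
    then show ?thesis
      by (simp add: carlitz_sum_coeff[of P d] d_def[symmetric] top lessThan_Suc_atMost[symmetric])
  qed
  then show "\<exists>h. \<forall>x. carlitz P x = x ^ (?q ^ d) + of_A P * eval_A h x" by blast
qed

section \<open>The torsion of the Carlitz module\<close>

lemma carlitz_division_finite:
  fixes M :: "'a::finite_field poly"
  assumes "M \<noteq> 0"
  shows "finite (carlitz_division M {a})"
    and "card (carlitz_division M {a}) \<le> CARD('a) ^ Polynomial.degree M"
proof -
  obtain P where P: "\<And>x. poly P x = carlitz M x"
    "Polynomial.degree P = CARD('a) ^ Polynomial.degree M"
    using carlitz_as_poly[OF assms] by blast
  have deg: "Polynomial.degree (P + [:- a:]) = CARD('a) ^ Polynomial.degree M"
    using P(2) by (subst degree_add_eq_left) auto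
  then have "P + [:- a:] \<noteq> 0" by (metis degree_0 zero_less_card_finite zero_less_power less_irrefl)
  note poly_roots_finite[OF this] card_poly_roots_bound[OF this]
  moreover have "{x. poly (P + [:- a:]) x = 0} = carlitz_division M {a}"
    using P(1) by (auto simp: carlitz_division_def)
  ultimately show "finite (carlitz_division M {a})"
    and "card (carlitz_division M {a}) \<le> CARD('a) ^ Polynomial.degree M"
    using deg by simp_all
qed

lemma carlitz_coprime_eq_0:
  fixes f g :: "'a::{finite_field,field_gcd} poly"
  assumes "coprime f g" "carlitz f x = 0" "carlitz g x = 0"
  shows "x = 0"
proof -
  obtain u v where "u * f + v * g = 1"
    using bezout_coefficients_fst_snd[of f g] assms(1) by (metis coprime_imp_gcd_eq_1)
  then have "x = carlitz (u * f + v * g) x" by simp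
  also have "\<dots> = 0"
    using assms by (simp add: carlitz_left_add carlitz_mult del: carlitz.scale_scale)
  finally show ?thesis .
qed

text \<open>The derivative of \<open>C_M\<close> is the nonzero constant \<open>M\<close>, so
  \<open>0\<close> is a simple root, while the degree exceeds \<open>1\<close>; hence there is
  another root.\<close>

lemma carlitz_torsion_nontrivial:
  fixes M :: "'a::finite_field poly"
  assumes "Polynomial.degree M > 0"
  shows "\<exists>x. x \<noteq> 0 \<and> carlitz M x = 0"
proof -
  define p where "p = map_poly of_A (carlitz_poly M)"
  have p: "poly p x = carlitz M x" for x
    using eval_carlitz_poly[of M x] by (simp add: p_def eval_A_def)
  have "M \<noteq> 0" using assms by auto
  then have deg: "Polynomial.degree p = CARD('a) ^ Polynomial.degree M"
    by (simp add: p_def degree_map_poly degree_carlitz_poly)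
  have der: "pderiv p = [:of_A M:]"
    unfolding p_def map_poly_of_A_pderiv[symmetric] pderiv_carlitz_poly
    by (simp add: map_poly_pCons)
  have "poly p 0 = 0" by (simp add: p)
  then obtain n where n: "p = [:0, 1:] * n" by (auto simp: poly_eq_0_iff_dvd)
  have "poly (pderiv p) 0 = poly n 0" unfolding n pderiv_mult by (simp add: pderiv_pCons)
  then have n0: "poly n 0 \<noteq> 0" using der \<open>M \<noteq> 0\<close> by (metis of_A_eq_0_iff poly_const_conv)
  then have "n \<noteq> 0" by auto
  then have "Polynomial.degree p = Suc (Polynomial.degree n)" by (simp add: n)
  moreover have "CARD('a) ^ Polynomial.degree M > 1"
    using assms card_finite_field_gt_1 by (intro one_less_power) auto
  ultimately have "Polynomial.degree n > 0" using deg by simp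
  then obtain y where y: "poly n y = 0" using alg_closed_imp_poly_has_root by blast
  then have "carlitz M y = 0" by (simp add: p[symmetric] n)
  moreover have "y \<noteq> 0" using n0 y by auto
  ultimately show ?thesis by blast
qed

lemma prime_poly_degree:
  fixes P :: "'a::field_gcd poly"
  assumes "prime_elem P"
  shows "Polynomial.degree P > 0"
  using assms by (auto simp: prime_elem_def is_unit_iff_degree)

text \<open>Built up prime by prime: if \<open>l\<close> has annihilator \<open>(M)\<close>, a
  \<open>Q\<close>-division point of \<open>l\<close> that is not killed by \<open>M\<close> has
  annihilator \<open>(Q * M)\<close>.\<close>

lemma carlitz_generator_exists:
  fixes M :: "'a::{finite_field,field_gcd} poly"
  assumes "M \<noteq> 0"
  shows "\<exists>l. \<forall>f. carlitz f l = 0 \<longleftrightarrow> M dvd f"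
  using assms
proof (induction M rule: prime_divisors_induct)
  case (unit M)
  then have "carlitz f 0 = 0 \<longleftrightarrow> M dvd f" for f by (simp add: unit_imp_dvd)
  then show ?case by blast
next
  case (factor Q M)
  then obtain l where l: "\<And>f. carlitz f l = 0 \<longleftrightarrow> M dvd f" by auto
  have Q: "prime_elem Q" "Q \<noteq> 0" using factor by auto
  have M: "M \<noteq> 0" using factor by auto
  obtain m where m: "carlitz Q m = l" using carlitz_surj[OF Q(2)] .
  obtain m' where m': "carlitz Q m' = l" "carlitz M m' \<noteq> 0"
  proof (cases "carlitz M m = 0")
    case True
    \<comment> \<open>Otherwise \<open>M / Q\<close> would kill \<open>l\<close>, against its
      annihilator being \<open>(M)\<close>. Hence a nonzero \<open>Q\<close>-torsion point is not
      killed by \<open>M\<close> and can be added to \<open>m\<close>.\<close>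
    have "\<not> Q dvd M"
    proof
      assume "Q dvd M"
      then obtain r where r: "M = r * Q" by (metis dvdE mult.commute)
      then have "carlitz r l = 0" using True m by (simp add: carlitz_mult del: carlitz.scale_scale)
      then have "M dvd r" by (simp add: l)
      then have "Q dvd 1"
        using M r by (metis dvd_mult_cancel_left mult.right_neutral mult_zero_left)
      then show False using Q by (simp add: prime_elem_def)
    qed
    then have "coprime Q M" using Q(1) by (intro prime_elem_imp_coprime)
    moreover obtain e where e: "e \<noteq> 0" "carlitz Q e = 0"
      using carlitz_torsion_nontrivial[OF prime_poly_degree[OF Q(1)]] by blast
    ultimately have "carlitz M e \<noteq> 0" using carlitz_coprime_eq_0 by blast
    then show ?thesis
      using e True m by (intro that[of "m + e"]) (simp_all add: carlitz_right_add)
  qed (use m that in blast)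
  have "carlitz f m' = 0 \<longleftrightarrow> Q * M dvd f" for f
  proof
    assume f: "carlitz f m' = 0"
    \<comment> \<open>Otherwise \<open>carlitz M m'\<close> would be a nonzero point killed by the
      coprime \<open>Q\<close> and \<open>f\<close>.\<close>
    have "Q dvd f"
    proof (rule ccontr)
      assume "\<not> Q dvd f"
      then have cop: "coprime Q f" using Q(1) by (intro prime_elem_imp_coprime)
      have "carlitz Q (carlitz M m') = carlitz M l"
        using m' carlitz.scale_left_commute by metis
      also have "\<dots> = 0" by (simp add: l)
      finally have "carlitz Q (carlitz M m') = 0" .
      moreover have "carlitz f (carlitz M m') = 0"
        using f carlitz.scale_left_commute[of f M m'] by simp
      ultimately show False using carlitz_coprime_eq_0[OF cop] m'(2) by blast
    qed
    then obtain g where g: "f = g * Q" by (metis dvdE mult.commute)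
    then have "carlitz g l = 0" using f m' by (simp add: carlitz_mult del: carlitz.scale_scale)
    then have "M dvd g" by (simp add: l)
    then show "Q * M dvd f" by (simp add: g mult.commute)
  next
    assume "Q * M dvd f"
    then obtain g where "f = (g * M) * Q" by (metis dvdE mult.commute mult.left_commute)
    then have "carlitz f m' = carlitz (g * M) l"
      using m' by (simp add: carlitz_mult del: carlitz.scale_scale)
    then show "carlitz f m' = 0" by (simp add: l)
  qed
  then show ?case by blast
qed simp

text \<open>By counting: a point with annihilator \<open>(M)\<close> has \<open>q^(deg M)\<close>
  distinct multiples by polynomials of degree below \<open>deg M\<close>, and the torsion has at
  most that many elements.\<close>

lemma carlitz_torsion_cyclic:
  fixes M :: "'a::{finite_field,field_gcd} poly"
  assumes "M \<noteq> 0"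
  obtains l where "carlitz_torsion M = range (\<lambda>f. carlitz f l)"
proof -
  obtain l where l: "\<And>f. carlitz f l = 0 \<longleftrightarrow> M dvd f"
    using carlitz_generator_exists[OF assms] by blast
  have sub: "range (\<lambda>f. carlitz f l) \<subseteq> carlitz_torsion M"
  proof safe
    fix f
    have "carlitz M (carlitz f l) = carlitz f (carlitz M l)"
      by (rule carlitz.scale_left_commute)
    then show "carlitz f l \<in> carlitz_torsion M" by (simp add: carlitz_torsion_def l)
  qed
  have tors: "carlitz_torsion M = carlitz_division M {0}"
    by (simp add: carlitz_torsion_def carlitz_division_def)
  let ?d = "Polynomial.degree M"
  let ?S = "{h :: 'a poly. \<forall>i\<ge>?d. Polynomial.coeff h i = 0}"
  have "inj_on (\<lambda>f. carlitz f l) ?S"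
  proof (rule inj_onI)
    fix g h assume gh: "g \<in> ?S" "h \<in> ?S" "carlitz g l = carlitz h l"
    then have "M dvd g - h" by (simp add: l[symmetric] carlitz.scale_left_diff_distrib)
    show "g = h"
    proof (rule ccontr)
      assume "g \<noteq> h"
      then have "?d \<le> Polynomial.degree (g - h)"
        using \<open>M dvd g - h\<close> by (intro dvd_imp_degree_le) auto
      then have "Polynomial.coeff (g - h) (Polynomial.degree (g - h)) = 0" using gh by simp
      then show False using \<open>g \<noteq> h\<close> by (simp only: leading_coeff_0_iff) simp
    qed
  qed
  then have card: "card ((\<lambda>f. carlitz f l) ` ?S) = CARD('a) ^ ?d"
    using card_poly_bounded[of ?d, where 'a = 'a] by (simp add: card_image)
  have "(\<lambda>f. carlitz f l) ` ?S = carlitz_torsion M"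
  proof (rule card_seteq)
    show "finite (carlitz_torsion M)" unfolding tors by (rule carlitz_division_finite[OF assms])
    show "(\<lambda>f. carlitz f l) ` ?S \<subseteq> carlitz_torsion M" using sub by blast
    show "card (carlitz_torsion M) \<le> card ((\<lambda>f. carlitz f l) ` ?S)"
      unfolding card tors by (rule carlitz_division_finite[OF assms])
  qed
  then have "carlitz_torsion M = range (\<lambda>f. carlitz f l)" using sub by blast
  then show ?thesis by (rule that)
qed

section \<open>Frobenius automorphisms\<close>

text \<open>A polynomial of least degree vanishing at \<open>x\<close> divides both \<open>p\<close>
  and \<open>h\<close>; as \<open>p\<close> is irreducible, the two are associated.\<close>

lemma irreducible_dvd_if_common_root:
  fixes p h :: "'b::field poly"
  assumes p: "Factorial_Ring.irreducible p" "poly (map_poly to_ac p) x = 0"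
    and h: "poly (map_poly to_ac h) x = 0"
  shows "p dvd h"
proof -
  define S where "S = {g. g \<noteq> 0 \<and> poly (map_poly to_ac g) x = 0}"
  have "p \<in> S" using p by (auto simp: S_def Factorial_Ring.irreducible_def)
  then obtain m where m: "m \<in> S" "\<And>g. g \<in> S \<Longrightarrow> Polynomial.degree m \<le> Polynomial.degree g"
    using ex_has_least_nat[of "\<lambda>g. g \<in> S" p Polynomial.degree] by blast
  have m_dvd: "m dvd g" if "poly (map_poly to_ac g) x = 0" for g
  proof -
    have "g mod m = g - g div m * m" by (simp add: minus_div_mult_eq_mod)
    then have "poly (map_poly to_ac (g mod m)) x = 0"
      using that m(1) by (simp add: poly_map_poly_diff poly_map_poly_mult S_def)
    moreover have "Polynomial.degree (g mod m) < Polynomial.degree m" if "g mod m \<noteq> 0"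
      using degree_mod_less[of m g] that m(1) by (auto simp: S_def)
    ultimately have "g mod m = 0" using m(2)[of "g mod m"] by (force simp: S_def)
    then show ?thesis by auto
  qed
  obtain s where s: "p = m * s" using m_dvd[OF p(2)] by blast
  have "\<not> m dvd 1"
  proof
    assume "m dvd 1"
    then obtain t where "1 = m * t" by blast
    then have "poly (map_poly to_ac 1) x = poly (map_poly to_ac m) x * poly (map_poly to_ac t) x"
      by (metis poly_map_poly_mult to_ac_0 to_ac_add to_ac_mult)
    then show False using m(1) by (simp add: S_def)
  qed
  then have "s dvd 1" using p(1) s by (auto simp: Factorial_Ring.irreducible_def)
  then have "p dvd m" by (simp add: s)
  then show ?thesis using m_dvd[OF h] by (rule dvd_trans)
qed

text \<open>One prime factor in the factorial ring \<open>A[X]\<close> must vanish at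
  \<open>x\<close>. Working over \<open>A\<close> keeps the cofactor integral too.\<close>

lemma irreducible_factor_root:
  fixes h :: "'a::field_gcd poly poly"
  assumes "h \<noteq> 0" "eval_A h x = 0"
  shows "\<exists>f. Factorial_Ring.irreducible f \<and> f dvd h \<and> eval_A f x = 0"
  using assms
proof (induction h rule: prime_divisors_induct)
  case (unit h)
  then obtain g where "1 = h * g" by blast
  then have "eval_A 1 x = eval_A h x * eval_A g x" by (metis eval_A_simps(6))
  then show ?case using unit by simp
next
  case (factor p h)
  show ?case
  proof (cases "eval_A p x = 0")
    case True
    then show ?thesis
      using factor by (intro exI[of _ p]) (auto intro: prime_elem_imp_irreducible)
  next
    case False
    then show ?thesis using factor by (auto intro: dvd_mult)
  qed
qed simp

text \<open>
  Dedekind's argument for the irreducibility of the cyclotomic polynomials: write \<open>C\<^sub>M = f g\<close> with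
  \<open>f\<close> the minimal polynomial of \<open>l\<close>. If \<open>l\<^sup>P\<close> were not a root of \<open>f\<close>, it would be one of \<open>g\<close>, and
  \<open>g(l)\<close> would be nilpotent modulo \<open>P\<close>; but \<open>g(l)\<close> divides \<open>C\<^sub>M'(l) = M\<close>, which is prime to \<open>P\<close>.
\<close>

lemma carlitz_prime_conjugate:
  fixes M P :: "'a::{finite_field,field_gcd} poly" and h :: "'a poly fract poly"
  assumes M: "M \<noteq> 0" "carlitz M l = 0"
    and P: "Factorial_Ring.irreducible P" "Polynomial.lead_coeff P = 1" "\<not> P dvd M"
    and h: "poly (map_poly to_ac h) l = 0"
  shows "poly (map_poly to_ac h) (carlitz P l) = 0"
proof -
  let ?Q = "CARD('a) ^ Polynomial.degree P"
  have CM: "carlitz_poly M \<noteq> 0"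
    using degree_carlitz_poly[OF M(1)] M(1) by auto
  obtain f where f: "Factorial_Ring.irreducible f" "f dvd carlitz_poly M" "eval_A f l = 0"
    using irreducible_factor_root[OF CM, of l] M(2) by (auto simp: eval_carlitz_poly)
  obtain g where g: "carlitz_poly M = f * g" using f(2) by blast
  have "f \<noteq> 0" using f(1) by auto
  have deg: "Polynomial.degree f \<noteq> 0"
  proof
    assume "Polynomial.degree f = 0"
    then obtain a where "f = [:a:]" by (elim degree_eq_zeroE)
    then show False using f(3) \<open>f \<noteq> 0\<close> by simp
  qed
  \<comment> \<open>The leading coefficient of \<open>C_M\<close> is a nonzero constant, hence a
    unit of \<open>A\<close>.\<close>
  have lc: "Polynomial.lead_coeff f dvd 1"
  proof -
    have "Polynomial.lead_coeff f * Polynomial.lead_coeff g = [:Polynomial.lead_coeff M:]"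
      using degree_carlitz_poly(2)[OF M(1)] by (simp only: g lead_coeff_mult)
    moreover have "[:Polynomial.lead_coeff M:] dvd 1"
      using M(1) by (simp add: is_unit_const_poly_iff dvd_field_iff)
    ultimately show ?thesis by (metis dvd_mult_left)
  qed
  \<comment> \<open>Gauss's lemma: \<open>f\<close> is primitive and stays irreducible over
    \<open>k\<close>.\<close>
  have irr: "Factorial_Ring.irreducible (fract_poly f)" "content f = 1"
    using nonconst_poly_irreducible_iff[OF deg] f(1) by auto
  have minimal: "fract_poly f dvd p" if "poly (map_poly to_ac p) l = 0" for p
    using irreducible_dvd_if_common_root[OF irr(1) _ that] f(3) by (simp add: eval_A_fract_poly)
  have "eval_A f (carlitz P l) = 0"
  proof (rule ccontr)
    assume nz: "eval_A f (carlitz P l) \<noteq> 0"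
    have "eval_A (carlitz_poly M) (carlitz P l) = carlitz P (carlitz M l)"
      unfolding eval_carlitz_poly by (rule carlitz.scale_left_commute)
    then have g0: "eval_A g (carlitz P l) = 0" using nz M(2) by (simp add: g)
    have "eval_A (pderiv (carlitz_poly M)) l = eval_A (pderiv f) l * eval_A g l"
      unfolding g pderiv_mult using f(3) by simp
    then have M_eq: "of_A M = eval_A (pderiv f) l * eval_A g l"
      by (simp add: pderiv_carlitz_poly)
    obtain s where s: "\<And>x. carlitz P x = x ^ ?Q + of_A P * eval_A s x"
      using carlitz_poly_irreducible(2)[OF P(1,2)] by blast
    have Pl: "carlitz P l = eval_A (Polynomial.monom 1 ?Q + [:P:] * s) l"
      by (simp add: s)
    \<comment> \<open>Modulo \<open>P\<close> in \<open>A[l]\<close>, raising to the power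
      \<open>?Q\<close> fixes the coefficients of \<open>p\<close> and takes \<open>l\<close> to
      \<open>carlitz P l\<close>, so it takes \<open>p(l)\<close> to
      \<open>p(carlitz P l)\<close>.\<close>
    have "\<exists>b. eval_A p l ^ ?Q - eval_A p (carlitz P l) = of_A P * eval_A b l" for p
    proof (induction p)
      case 0
      then show ?case using card_finite_field_gt_1[where 'a = 'a]
        by (intro exI[of _ 0]) (simp add: zero_power)
    next
      case (pCons a p)
      then obtain b where b: "eval_A p l ^ ?Q - eval_A p (carlitz P l) = of_A P * eval_A b l" by blast
      have frob: "(x + y) ^ (CARD('a) ^ n) = x ^ (CARD('a) ^ n) + y ^ (CARD('a) ^ n)"
        for x y :: "'a kbar" and n
        by (induction n arbitrary: x y) (simp_all add: frobenius_add power_mult)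
      obtain r where r: "a ^ ?Q - a = P * r"
        using dvd_frobenius_diff[OF carlitz_poly_irreducible(1)[OF P(1,2)], of a] by blast
      have r': "of_A a ^ ?Q = of_A a + of_A P * of_A r"
        using arg_cong[OF r, of of_A] by (simp add: algebra_simps)
      obtain t where t: "eval_A p (carlitz P l) = eval_A t l"
      proof -
        have "eval_A p (eval_A u l) = eval_A (pcompose p u) l" for u
          by (induction p) (simp_all add: pcompose_pCons)
        then show ?thesis using that Pl by metis
      qed
      have b': "eval_A p l ^ ?Q = eval_A t l + of_A P * eval_A b l"
        using b t by (simp add: algebra_simps)
      have "eval_A (pCons a p) l ^ ?Q - eval_A (pCons a p) (carlitz P l) =
          of_A P * (of_A r + l ^ ?Q * eval_A b l - eval_A s l * eval_A t l)"
        unfolding eval_A_simps(3) frob power_mult_distrib r' b' t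
        unfolding s by (simp add: algebra_simps)
      then show ?case
        by (intro exI[of _ "[:r:] + Polynomial.monom 1 ?Q * b - s * t"]) simp
    qed
    from this[of g] obtain b where b: "eval_A g l ^ ?Q = of_A P * eval_A b l"
      by (auto simp: g0)
    \<comment> \<open>In \<open>A[l]\<close> the prime \<open>P\<close> divides a power of
      \<open>M\<close>; being prime to \<open>M\<close> in \<open>A\<close>, it becomes invertible
      in \<open>A[l]\<close>, with inverse \<open>z(l)\<close>.\<close>
    have "of_A M ^ ?Q = of_A P * eval_A (pderiv f ^ ?Q * b) l"
      by (simp add: M_eq power_mult_distrib b)
    then obtain w where w: "of_A (M ^ ?Q) = of_A P * eval_A w l" by (metis of_A_power)
    have "prime_elem P" using P(1) by (rule irreducible_imp_prime_elem)
    then have "\<not> P dvd M ^ ?Q" using P(3) prime_elem_dvd_power by blast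
    then have "coprime P (M ^ ?Q)" by (rule irreducible_poly_coprime[OF P(1)])
    then obtain u v where uv: "u * P + v * M ^ ?Q = 1"
      using bezout_coefficients_fst_snd[of P "M ^ ?Q"] by (metis coprime_imp_gcd_eq_1)
    define z where "z = [:u:] + [:v:] * w"
    have "of_A (u * P + v * M ^ ?Q) = of_A P * eval_A z l"
      using w by (simp add: z_def algebra_simps del: of_A_power)
    then have z: "of_A P * eval_A z l = 1" by (simp add: uv)
    \<comment> \<open>Reducing \<open>z\<close> modulo \<open>f\<close> costs only the factor
      \<open>k\<close>, a power of the unit leading coefficient. A relation of degree below
      \<open>deg f\<close> is trivial, so its constant term shows that \<open>P\<close> divides the
      unit \<open>k\<close>.\<close>
    obtain c r where cr: "pseudo_divmod z f = (c, r)" by fastforce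
    define k where "k = Polynomial.lead_coeff f ^ (Suc (Polynomial.degree z) - Polynomial.degree f)"
    have kz: "Polynomial.smult k z = f * c + r" "r = 0 \<or> Polynomial.degree r < Polynomial.degree f"
      using pseudo_divmod[OF \<open>f \<noteq> 0\<close> cr] by (simp_all add: k_def)
    have "eval_A ([:k:] - Polynomial.smult P r) l = 0"
    proof -
      have "of_A k * eval_A z l = eval_A r l"
        using arg_cong[OF kz(1), of "\<lambda>p. eval_A p l"] f(3) by simp
      then have "of_A P * eval_A r l = of_A k * (of_A P * eval_A z l)" by (simp add: algebra_simps)
      then show ?thesis by (simp add: z)
    qed
    then have "fract_poly f dvd fract_poly ([:k:] - Polynomial.smult P r)"
      by (intro minimal) (simp only: eval_A_fract_poly)
    then have "f dvd [:k:] - Polynomial.smult P r" using irr(2) by (rule fract_poly_dvdD)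
    moreover have "Polynomial.degree ([:k:] - Polynomial.smult P r) < Polynomial.degree f"
      using kz(2) deg degree_smult_le[of P r] by (intro degree_diff_less) auto
    ultimately have "[:k:] - Polynomial.smult P r = 0"
      using dvd_imp_degree_le leD by blast
    then have "k = P * Polynomial.coeff r 0" by (metis coeff_pCons_0 coeff_smult eq_iff_diff_eq_0)
    moreover have "k dvd 1"
      using lc unfolding k_def by (metis dvd_power_same power_one)
    ultimately have "P dvd 1" by (metis dvd_mult_left)
    then show False using P(1) by (simp add: Factorial_Ring.irreducible_def)
  qed
  moreover obtain s where "h = fract_poly f * s" using minimal[OF h] by blast
  ultimately show ?thesis by (simp add: poly_map_poly_mult eval_A_fract_poly)
qed

section \<open>Endomorphisms over \<open>k\<close> and the Carlitz action\<close>

context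
  fixes \<sigma> :: "'a::field kbar \<Rightarrow> 'a kbar"
  assumes \<sigma>: "ac_hom \<sigma>"
begin

lemma ac_hom_add: "\<sigma> (x + y) = \<sigma> x + \<sigma> y"
  and ac_hom_mult: "\<sigma> (x * y) = \<sigma> x * \<sigma> y"
  and ac_hom_to_ac: "\<sigma> (to_ac c) = to_ac c"
  using \<sigma> by (simp_all add: ac_hom_def)

lemma ac_hom_0: "\<sigma> 0 = 0" and ac_hom_1: "\<sigma> 1 = 1"
  using ac_hom_to_ac[of 0] ac_hom_to_ac[of 1] by simp_all

lemma ac_hom_diff: "\<sigma> (x - y) = \<sigma> x - \<sigma> y"
  using ac_hom_add[of "x - y" y] by (simp add: algebra_simps)

lemma ac_hom_minus: "\<sigma> (- x) = - \<sigma> x"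
  using ac_hom_diff[of 0 x] by (simp add: ac_hom_0)

lemma ac_hom_inverse: "\<sigma> (inverse x) = inverse (\<sigma> x)"
proof (cases "x = 0")
  case False
  then have "\<sigma> x * \<sigma> (inverse x) = 1" by (simp add: ac_hom_1 flip: ac_hom_mult)
  then show ?thesis by (metis inverse_unique)
qed (simp add: ac_hom_0)

lemma ac_hom_inj: "inj \<sigma>"
proof (rule injI)
  fix x y assume "\<sigma> x = \<sigma> y"
  then have "\<sigma> (x - y) * \<sigma> (inverse (x - y)) = 0" by (simp add: ac_hom_diff)
  then have "\<sigma> ((x - y) * inverse (x - y)) = 0" by (simp add: ac_hom_mult)
  then show "x = y" using ac_hom_1 by (metis eq_iff_diff_eq_0 right_inverse zero_neq_one)
qed

lemma ac_hom_power: "\<sigma> (x ^ n) = \<sigma> x ^ n"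
  by (induction n) (simp_all add: ac_hom_mult ac_hom_1)

lemma ac_hom_carlitz: "\<sigma> (carlitz f x) = carlitz f (\<sigma> x)"
proof (induction f arbitrary: x)
  case 0
  then show ?case by (simp add: ac_hom_0)
next
  case (pCons a f)
  have "\<sigma> (carlitz_T x) = carlitz_T (\<sigma> x)" for x
    by (simp add: carlitz_T_def ac_hom_add ac_hom_mult ac_hom_power ac_hom_to_ac of_A_def)
  then show ?case
    by (simp add: carlitz_pCons ac_hom_add ac_hom_mult ac_hom_to_ac of_A_def pCons.IH)
qed

end

lemma ac_hom_comp: "ac_hom \<sigma> \<Longrightarrow> ac_hom \<rho> \<Longrightarrow> ac_hom (\<lambda>x. \<sigma> (\<rho> x))"
  by (simp add: ac_hom_def)

text \<open>By \<open>carlitz_prime_conjugate\<close> a generator \<open>l\<close> of the torsion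
  can be sent to \<open>carlitz P l\<close>; commuting with the Carlitz action, the resulting
  endomorphism acts as \<open>P\<close> on all torsion points.\<close>

lemma prime_frobenius_exists:
  fixes M P :: "'a::{finite_field,field_gcd} poly"
  assumes M: "M \<noteq> 0"
    and P: "Factorial_Ring.irreducible P" "Polynomial.lead_coeff P = 1" "\<not> P dvd M"
  shows "\<exists>\<sigma>. ac_hom \<sigma> \<and> (\<forall>x\<in>carlitz_torsion M. \<sigma> x = carlitz P x)"
proof -
  obtain l where l: "carlitz_torsion M = range (\<lambda>f. carlitz f l)"
    using carlitz_torsion_cyclic[OF M] .
  then have "carlitz 1 l \<in> carlitz_torsion M" by blast
  then have Ml: "carlitz M l = 0" by (simp add: carlitz_torsion_def)
  \<comment> \<open>The graph of the identity on \<open>k\<close>.\<close>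
  define R where "R = range (\<lambda>c. (to_ac c :: 'a kbar, to_ac c :: 'a kbar))"
  have R: "partial_hom R"
    unfolding partial_hom_def R_def by (auto simp flip: to_ac_add to_ac_mult)
  have "poly q (carlitz P l) = 0" if pq: "rel_poly R p q" "poly p l = 0" for p q
  proof -
    have c: "Polynomial.coeff p i \<in> range to_ac" "Polynomial.coeff q i = Polynomial.coeff p i" for i
    proof -
      have "(Polynomial.coeff p i, Polynomial.coeff q i) \<in> R"
        using pq(1) by (simp add: rel_poly_def)
      then show "Polynomial.coeff p i \<in> range to_ac" "Polynomial.coeff q i = Polynomial.coeff p i"
        by (auto simp: R_def)
    qed
    have p: "p = map_poly to_ac (map_poly of_ac p)"
      by (simp add: poly_eq_iff coeff_map_poly to_ac_of_ac[OF c(1)])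
    have "q = p" using c(2) by (simp add: poly_eq_iff)
    moreover have "poly (map_poly to_ac (map_poly of_ac p)) (carlitz P l) = 0"
      using pq(2) p by (intro carlitz_prime_conjugate[OF M Ml P]) simp
    ultimately show ?thesis using p by simp
  qed
  then obtain R' where R': "partial_hom R'" "R \<subseteq> R'" "(l, carlitz P l) \<in> R'"
    using partial_hom_adjoin[OF R] by metis
  obtain \<sigma> where \<sigma>: "ac_hom \<sigma>" "\<And>a b. (a, b) \<in> R' \<Longrightarrow> \<sigma> a = b"
    using partial_hom_extend[OF R'(1)] by blast
  have "\<sigma> (carlitz f l) = carlitz P (carlitz f l)" for f
    using ac_hom_carlitz[OF \<sigma>(1), of f l] \<sigma>(2)[OF R'(3)] carlitz.scale_left_commute[of f P l]
    by simp
  then show ?thesis using \<sigma>(1) by (auto simp: l)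
qed

lemma normalize_poly_monic:
  fixes B :: "'a::field_gcd poly"
  assumes "B \<noteq> 0"
  shows "normalize B = B \<longleftrightarrow> Polynomial.lead_coeff B = 1"
proof -
  have eq: "normalize B = Polynomial.smult (inverse (Polynomial.lead_coeff B)) B"
    using assms by (simp add: normalize_poly_eq_map_poly smult_conv_map_poly
        is_unit_unit_factor dvd_field_iff divide_inverse mult.commute)
  then have lc: "Polynomial.lead_coeff (normalize B) = 1" using assms by simp
  show ?thesis
  proof
    assume "normalize B = B"
    then show "Polynomial.lead_coeff B = 1" using lc by metis
  next
    assume "Polynomial.lead_coeff B = 1"
    then show "normalize B = B" by (simp add: eq)
  qed
qed

lemma frobenius_exists:
  fixes M B :: "'a::{finite_field,field_gcd} poly"
  assumes "M \<noteq> 0" "coprime B M" "Polynomial.lead_coeff B = 1"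
  shows "\<exists>\<sigma>. ac_hom \<sigma> \<and> (\<forall>x\<in>carlitz_torsion M. \<sigma> x = carlitz B x)"
proof -
  \<comment> \<open>The induction over prime factors passes through units, so it is run for
    \<open>normalize B\<close>; a monic \<open>B\<close> is its own normalization.\<close>
  have "\<exists>\<sigma>. ac_hom \<sigma> \<and> (\<forall>x\<in>carlitz_torsion M. \<sigma> x = carlitz (normalize B) x)"
    if "B \<noteq> 0" "coprime B M" for B
    using that
  proof (induction B rule: prime_divisors_induct)
    case (unit B)
    then have "normalize B = 1" by (simp add: is_unit_normalize)
    then show ?case by (intro exI[of _ "\<lambda>x. x"]) (simp add: ac_hom_def)
  next
    case (factor P B)
    have P: "prime_elem P" "normalize P = P" "P \<noteq> 0" using factor by auto
    have "\<not> P dvd M"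
      using factor.prems(2) P(1) by (metis coprime_common_divisor dvd_triv_left prime_elem_not_unit)
    then obtain \<sigma> where \<sigma>: "ac_hom \<sigma>" "\<And>x. x \<in> carlitz_torsion M \<Longrightarrow> \<sigma> x = carlitz P x"
      using prime_frobenius_exists[OF assms(1), of P] P
      by (auto simp: prime_elem_imp_irreducible normalize_poly_monic)
    obtain \<rho> where \<rho>: "ac_hom \<rho>" "\<And>x. x \<in> carlitz_torsion M \<Longrightarrow> \<rho> x = carlitz (normalize B) x"
      using factor by auto
    have "\<rho> (\<sigma> x) = carlitz (normalize (P * B)) x" if "x \<in> carlitz_torsion M" for x
      using that \<sigma>(2) \<rho>(2) P(2) ac_hom_carlitz[OF \<rho>(1)]
      by (simp add: normalize_mult carlitz_mult del: carlitz.scale_scale)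
    then show ?case using ac_hom_comp[OF \<rho>(1) \<sigma>(1)] by blast
  qed simp
  moreover have "B \<noteq> 0" using assms(3) by auto
  ultimately show ?thesis using assms normalize_poly_monic by metis
qed

section \<open>Descent of division points\<close>

text \<open>Recasts the induction rule of \<open>generate_field\<close> in terms of the type class
  operations instead of those of the ring record.\<close>

lemma adjoin_induct [consumes 1, case_names base gen add mult minus inverse]:
  assumes "x \<in> adjoin S"
    and "\<And>c. Q (to_ac c)" "\<And>s. s \<in> S \<Longrightarrow> Q s"
    and "\<And>x y. x \<in> adjoin S \<Longrightarrow> y \<in> adjoin S \<Longrightarrow> Q x \<Longrightarrow> Q y \<Longrightarrow> Q (x + y)"
    and "\<And>x y. x \<in> adjoin S \<Longrightarrow> y \<in> adjoin S \<Longrightarrow> Q x \<Longrightarrow> Q y \<Longrightarrow> Q (x * y)"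
    and "\<And>x. x \<in> adjoin S \<Longrightarrow> Q x \<Longrightarrow> Q (- x)"
    and "\<And>x. x \<in> adjoin S \<Longrightarrow> x \<noteq> 0 \<Longrightarrow> Q x \<Longrightarrow> Q (inverse x)"
  shows "Q x"
proof -
  let ?R = "ring_of_type_algebra :: 'a kbar ring"
  interpret R: Ring.field ?R by (rule field_from_type_algebra)
  have R: "\<zero>\<^bsub>?R\<^esub> = 0" "\<one>\<^bsub>?R\<^esub> = 1" "x \<oplus>\<^bsub>?R\<^esub> y = x + y" "x \<otimes>\<^bsub>?R\<^esub> y = x * y"
    "carrier ?R = UNIV" for x y
    by (simp_all add: ring_of_type_algebra_def)
  have minus: "\<ominus>\<^bsub>?R\<^esub> x = - x" for x
    by (rule R.minus_equality) (simp_all add: R)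
  have inv: "inv\<^bsub>?R\<^esub> x = inverse x" if "x \<noteq> 0" for x
    using that by (intro R.comm_inv_char) (simp_all add: R)
  show ?thesis
    using assms(1) unfolding adjoin_def
  proof (induction rule: generate_field.induct)
    case one
    then show ?case using assms(2)[of 1] by (simp add: R)
  qed (use assms in \<open>auto simp: R minus inv adjoin_def\<close>)
qed

lemma adjoin_inverse:
  assumes "x \<in> adjoin S"
  shows "inverse x \<in> adjoin S"
proof (cases "x = 0")
  case False
  let ?R = "ring_of_type_algebra :: 'a kbar ring"
  interpret R: Ring.field ?R by (rule field_from_type_algebra)
  have "inv\<^bsub>?R\<^esub> x = inverse x"
    using False by (intro R.comm_inv_char) (simp_all add: ring_of_type_algebra_def)
  then show ?thesis
    using generate_field.m_inv[of x ?R] assms False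
    by (simp add: adjoin_def ring_of_type_algebra_def)
qed (use assms in simp)

lemma adjoin_to_ac: "to_ac c \<in> adjoin S"
  using adjoin_closed(1)[of S] by blast

lemma adjoin_minus: "x \<in> adjoin S \<Longrightarrow> - x \<in> adjoin S"
  using adjoin_closed(3)[OF adjoin_to_ac[of "-1"], of x S] by simp

lemma ac_hom_eq_on_adjoin:
  assumes "ac_hom \<sigma>" "ac_hom \<rho>" "\<And>s. s \<in> S \<Longrightarrow> \<sigma> s = \<rho> s" "x \<in> adjoin S"
  shows "\<sigma> x = \<rho> x"
  using assms(4)
  by (induction rule: adjoin_induct)
     (simp_all add: assms(3) ac_hom_to_ac[OF assms(1)] ac_hom_to_ac[OF assms(2)]
      ac_hom_add[OF assms(1)] ac_hom_add[OF assms(2)] ac_hom_mult[OF assms(1)] ac_hom_mult[OF assms(2)]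
      ac_hom_minus[OF assms(1)] ac_hom_minus[OF assms(2)]
      ac_hom_inverse[OF assms(1)] ac_hom_inverse[OF assms(2)])

text \<open>The derivative of \<open>C_M(X) - carlitz M x\<close> is the nonzero constant
  \<open>M\<close>, so \<open>x\<close> is a simple root of a polynomial over
  \<open>F\<close>.\<close>

lemma ac_hom_moving_division:
  fixes M :: "'a::finite_field poly"
  assumes "M \<noteq> 0" "range to_ac \<subseteq> F" "\<And>a b. a \<in> F \<Longrightarrow> b \<in> F \<Longrightarrow> a + b \<in> F"
    "\<And>a b. a \<in> F \<Longrightarrow> b \<in> F \<Longrightarrow> a * b \<in> F"
    and x: "carlitz M x \<in> F" "x \<notin> F"
  obtains \<sigma> where "ac_hom \<sigma>" "\<And>c. c \<in> F \<Longrightarrow> \<sigma> c = c" "\<sigma> x \<noteq> x"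
proof -
  define p where "p = map_poly of_A (carlitz_poly M) + [:- carlitz M x:]"
  have "to_ac (- 1) * carlitz M x \<in> F" using assms by blast
  then have neg: "- carlitz M x \<in> F" by simp
  have zero: "0 \<in> F" using assms(2) rangeI[of to_ac 0] by auto
  have "Polynomial.coeff [:- carlitz M x:] i \<in> F" for i
    using neg zero by (simp add: coeff_pCons split: nat.splits)
  moreover have "of_A g \<in> F" for g using assms(2) by (auto simp: of_A_def)
  ultimately have "Polynomial.coeff p i \<in> F" for i
    unfolding p_def by (auto simp: coeff_map_poly intro!: assms(3))
  moreover have "poly p x = 0"
    using eval_carlitz_poly[of M x] by (simp add: p_def eval_A_def)
  moreover have "pderiv p = [:of_A M:]"
    unfolding p_def pderiv_add map_poly_of_A_pderiv[symmetric] pderiv_carlitz_poly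
    by (simp add: map_poly_pCons)
  then have "poly (pderiv p) x \<noteq> 0" using assms(1) by simp
  ultimately show ?thesis
    using ac_hom_moving[of F p x] assms(2-4) x(2) that by blast
qed

text \<open>If \<open>u * f + v * M = 1\<close>, then \<open>carlitz u x\<close> is a preimage of
  \<open>x\<close>.\<close>

lemma carlitz_coprime_surj:
  fixes M f :: "'a::{finite_field,field_gcd} poly"
  assumes "coprime f M" "x \<in> carlitz_torsion M"
  shows "\<exists>y\<in>carlitz_torsion M. carlitz f y = x"
proof -
  obtain u v where uv: "u * f + v * M = 1"
    using bezout_coefficients_fst_snd[of f M] assms(1) by (metis coprime_imp_gcd_eq_1)
  have Mx: "carlitz M x = 0" using assms(2) by (simp add: carlitz_torsion_def)
  have "x = carlitz (u * f + v * M) x" by (simp add: uv)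
  also have "\<dots> = carlitz f (carlitz u x)"
    using Mx carlitz.scale_left_commute[of u f x]
    by (simp add: carlitz_left_add carlitz_mult del: carlitz.scale_scale)
  finally have "carlitz f (carlitz u x) = x" by simp
  moreover have "carlitz M (carlitz u x) = 0"
    using Mx carlitz.scale_left_commute[of M u x] by simp
  ultimately show ?thesis unfolding carlitz_torsion_def by blast
qed

text \<open>
  Sah's argument: \<open>\<sigma>\<close> is central in the Galois group of the cyclotomic field, and \<open>\<sigma> - 1\<close> acts
  invertibly on \<open>\<Lambda>\<^sub>M\<close>. So \<open>\<alpha>\<close> can be corrected by a torsion point to be fixed by \<open>\<sigma>\<close>, and then it
  is fixed by the whole Galois group.
\<close>

lemma division_point_descent:
  fixes M B :: "'a::{finite_field,field_gcd} poly"
  assumes M: "M \<noteq> 0" and \<alpha>: "\<alpha> \<in> cyclotomic_field M" "carlitz M \<alpha> \<in> range to_ac"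
    and \<sigma>: "ac_hom \<sigma>" "\<And>x. x \<in> carlitz_torsion M \<Longrightarrow> \<sigma> x = carlitz B x"
    and B: "coprime (B - 1) M"
  obtains \<beta> where "\<beta> \<in> range to_ac" "carlitz M \<beta> = carlitz M \<alpha>"
proof -
  have tors: "\<rho> x - x \<in> carlitz_torsion M" if "ac_hom \<rho>" "carlitz M x = carlitz M \<alpha>" for \<rho> x
  proof -
    have "carlitz M (\<rho> x) = \<rho> (carlitz M x)" by (simp add: ac_hom_carlitz[OF that(1)])
    also have "\<dots> = carlitz M x" using that \<alpha>(2) ac_hom_to_ac[OF that(1)] by auto
    finally show ?thesis by (simp add: carlitz_torsion_def carlitz.scale_right_diff_distrib)
  qed
  \<comment> \<open>As \<sigma> acts on \<nu> as \<open>B\<close>, this says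
    \<open>\<sigma> \<nu> - \<nu> = \<sigma> \<alpha> - \<alpha>\<close>, so \<sigma> fixes
    \<open>\<alpha> - \<nu>\<close>.\<close>
  obtain \<nu> where \<nu>: "\<nu> \<in> carlitz_torsion M" "carlitz (B - 1) \<nu> = \<sigma> \<alpha> - \<alpha>"
    using carlitz_coprime_surj[OF B tors[OF \<sigma>(1) refl]] by blast
  define \<beta> where "\<beta> = \<alpha> - \<nu>"
  have M\<beta>: "carlitz M \<beta> = carlitz M \<alpha>"
    using \<nu>(1) by (simp add: \<beta>_def carlitz.scale_right_diff_distrib carlitz_torsion_def)
  have "\<nu> \<in> cyclotomic_field M" using \<nu>(1) kummer_field_facts(2) by blast
  then have \<beta>K: "\<beta> \<in> cyclotomic_field M"
    using adjoin_closed(2)[OF \<alpha>(1)[unfolded cyclotomic_field_def] adjoin_minus]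
    by (simp add: \<beta>_def cyclotomic_field_def)
  have \<sigma>\<beta>: "\<sigma> \<beta> = \<beta>"
    using \<nu> \<sigma>(2) by (simp add: \<beta>_def ac_hom_diff[OF \<sigma>(1)] carlitz.scale_left_diff_distrib algebra_simps)
  have "\<beta> \<in> range to_ac"
  proof (rule ccontr)
    assume \<beta>: "\<beta> \<notin> range to_ac"
    have "carlitz M \<beta> \<in> range to_ac" using \<alpha>(2) M\<beta> by simp
    moreover have "x + y \<in> range to_ac" "x * y \<in> range to_ac"
      if "x \<in> range to_ac" "y \<in> range to_ac" for x y :: "'a kbar"
      using that by (auto simp flip: to_ac_add to_ac_mult)
    ultimately obtain \<rho> where \<rho>: "ac_hom \<rho>" "\<rho> \<beta> \<noteq> \<beta>"
      using ac_hom_moving_division[OF M order.refl _ _ _ \<beta>] by metis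
    \<comment> \<open>It suffices to compare on the torsion, where \<sigma> acts as
      \<open>B\<close>, while \<rho> commutes with the Carlitz action.\<close>
    have "\<sigma> (\<rho> \<beta>) = \<rho> (\<sigma> \<beta>)"
    proof (rule ac_hom_eq_on_adjoin[OF ac_hom_comp[OF \<sigma>(1) \<rho>(1)] ac_hom_comp[OF \<rho>(1) \<sigma>(1)]])
      show "\<beta> \<in> adjoin (carlitz_torsion M)" using \<beta>K by (simp add: cyclotomic_field_def)
      fix s assume s: "s \<in> carlitz_torsion M"
      then have "\<rho> s \<in> carlitz_torsion M"
        by (simp add: carlitz_torsion_def ac_hom_0[OF \<rho>(1)] flip: ac_hom_carlitz[OF \<rho>(1)])
      then show "\<sigma> (\<rho> s) = \<rho> (\<sigma> s)" using s by (simp add: \<sigma>(2) ac_hom_carlitz[OF \<rho>(1)])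
    qed
    define \<epsilon> where "\<epsilon> = \<rho> \<beta> - \<beta>"
    have \<epsilon>: "\<epsilon> \<in> carlitz_torsion M" unfolding \<epsilon>_def by (rule tors[OF \<rho>(1) M\<beta>])
    have "\<sigma> \<epsilon> = \<epsilon>"
      using \<open>\<sigma> (\<rho> \<beta>) = \<rho> (\<sigma> \<beta>)\<close> \<sigma>\<beta> by (simp add: \<epsilon>_def ac_hom_diff[OF \<sigma>(1)])
    \<comment> \<open>A torsion point fixed by \<sigma> is killed by the coprime
      \<open>B - 1\<close> and \<open>M\<close>.\<close>
    then have "carlitz (B - 1) \<epsilon> = 0"
      using \<sigma>(2)[OF \<epsilon>] by (simp add: carlitz.scale_left_diff_distrib)
    moreover have "carlitz M \<epsilon> = 0" using \<epsilon> by (simp add: carlitz_torsion_def)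
    ultimately have "\<epsilon> = 0" by (rule carlitz_coprime_eq_0[OF B])
    then show False using \<rho>(2) by (simp add: \<epsilon>_def)
  qed
  then show ?thesis using that M\<beta> by blast
qed

text \<open>The point is surjectivity: \<sigma> permutes the finite set of \<open>M\<close>-division
  points of each element of \<open>k\<close>, hence maps the generators of the Kummer field onto
  themselves.\<close>

lemma restrict_in_kummer_group:
  fixes M :: "'a::finite_field poly"
  assumes "M \<noteq> 0" "\<Gamma> \<subseteq> range to_ac" and \<sigma>: "ac_hom \<sigma>"
    and fixed: "\<And>x. x \<in> cyclotomic_field M \<Longrightarrow> \<sigma> x = x"
  shows "restrict \<sigma> (kummer_field M \<Gamma>) \<in> carrier (kummer_group M \<Gamma>)"
proof -
  let ?S = "carlitz_torsion M \<union> carlitz_division M \<Gamma>" and ?L = "kummer_field M \<Gamma>"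
  have L: "?L = adjoin ?S" by (simp add: kummer_field_def)
  have gen: "\<sigma> ` carlitz_division M {a} = carlitz_division M {a}" if "a \<in> range to_ac" for a
  proof (rule endo_inj_surj)
    show "finite (carlitz_division M {a})" by (rule carlitz_division_finite[OF assms(1)])
    show "\<sigma> ` carlitz_division M {a} \<subseteq> carlitz_division M {a}"
      using that ac_hom_to_ac[OF \<sigma>] by (auto simp: carlitz_division_def simp flip: ac_hom_carlitz[OF \<sigma>])
    show "inj_on \<sigma> (carlitz_division M {a})"
      using ac_hom_inj[OF \<sigma>] by (rule inj_on_subset) simp
  qed
  \<comment> \<open>Torsion points are the division points of \<open>0\<close>, which is inserted
    because \<Gamma> is any subset of \<open>k\<close> here.\<close>
  have S: "?S = (\<Union>a\<in>insert 0 \<Gamma>. carlitz_division M {a})"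
    by (auto simp: carlitz_division_def carlitz_torsion_def)
  have "insert 0 \<Gamma> \<subseteq> range to_ac" using assms(2) rangeI[of to_ac 0] by simp
  then have gen_S: "\<sigma> ` ?S = ?S"
    unfolding S image_UN by (intro SUP_cong refl gen) blast
  have into: "\<sigma> x \<in> ?L" if "x \<in> ?L" for x
    using that unfolding L
  proof (induction rule: adjoin_induct)
    case (gen s)
    then have "\<sigma> s \<in> ?S" using gen_S by blast
    then show ?case using adjoin_closed(1) by blast
  next
    case (base c)
    then show ?case unfolding ac_hom_to_ac[OF \<sigma>] by (rule adjoin_to_ac)
  next
    case (add x y)
    then show ?case unfolding ac_hom_add[OF \<sigma>] by (intro adjoin_closed(2))
  next
    case (mult x y)
    then show ?case unfolding ac_hom_mult[OF \<sigma>] by (intro adjoin_closed(3))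
  next
    case (minus x)
    then show ?case unfolding ac_hom_minus[OF \<sigma>] by (intro adjoin_minus)
  next
    case (inverse x)
    then show ?case unfolding ac_hom_inverse[OF \<sigma>] by (intro adjoin_inverse)
  qed
  have onto: "x \<in> \<sigma> ` ?L" if "x \<in> ?L" for x
    using that unfolding L
  proof (induction rule: adjoin_induct)
    case (base c)
    then show ?case using ac_hom_to_ac[OF \<sigma>, of c] adjoin_to_ac by (metis imageI)
  next
    case (gen s)
    then have "s \<in> \<sigma> ` ?S" using gen_S by blast
    then show ?case using adjoin_closed(1) by blast
  next
    case (add x y)
    then show ?case by (auto simp flip: ac_hom_add[OF \<sigma>] intro!: imageI adjoin_closed(2))
  next
    case (mult x y)
    then show ?case by (auto simp flip: ac_hom_mult[OF \<sigma>] intro!: imageI adjoin_closed(3))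
  next
    case (minus x)
    then show ?case by (auto simp flip: ac_hom_minus[OF \<sigma>] intro!: imageI adjoin_minus)
  next
    case (inverse x)
    then show ?case by (auto simp flip: ac_hom_inverse[OF \<sigma>] intro!: imageI adjoin_inverse)
  qed
  have "\<sigma> ` ?L = ?L" using into onto by blast
  then have "bij_betw \<sigma> ?L ?L"
    using inj_on_subset[OF ac_hom_inj[OF \<sigma>] subset_UNIV] by (simp add: bij_betw_def)
  then have "bij_betw (restrict \<sigma> ?L) ?L ?L"
    by (rule bij_betw_cong[THEN iffD1, rotated]) simp
  moreover have "x + y \<in> ?L" "x * y \<in> ?L" if "x \<in> ?L" "y \<in> ?L" for x y
    using that adjoin_closed(2,3)[of x ?S y] by (simp_all add: L)
  moreover have "1 \<in> ?L" using adjoin_to_ac[of 1 ?S] by (simp add: L)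
  ultimately have "restrict \<sigma> ?L \<in> ring_iso (ring_of_type_algebra\<lparr>carrier := ?L\<rparr>)
      (ring_of_type_algebra\<lparr>carrier := ?L\<rparr>)"
    using into by (simp add: ring_iso_def ring_hom_def ring_of_type_algebra_def Pi_iff
        ac_hom_add[OF \<sigma>] ac_hom_mult[OF \<sigma>] ac_hom_1[OF \<sigma>])
  moreover have "restrict \<sigma> ?L x = x" if "x \<in> cyclotomic_field M" for x
    using that fixed kummer_field_facts(3)[of M \<Gamma>] by auto
  ultimately show ?thesis by (simp add: kummer_group_def galois_group_def)
qed

text \<open>Otherwise separability yields an endomorphism fixing \<open>K\<close> and moving
  \<alpha>; its restriction to the Kummer field is a group element at which
  \<open>kummer_map M \<Gamma> a\<close> is nonzero.\<close>

lemma kummer_kernel_division_point: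
  fixes M :: "'a::finite_field poly"
  assumes "M \<noteq> 0" "\<Gamma> \<subseteq> range to_ac" "a \<in> kummer_kernel M \<Gamma>" "carlitz M \<alpha> = a"
  shows "\<alpha> \<in> cyclotomic_field M"
proof (rule ccontr)
  let ?K = "cyclotomic_field M"
  assume \<alpha>: "\<alpha> \<notin> ?K"
  have a: "a \<in> \<Gamma>" "kummer_map M \<Gamma> a = \<one>\<^bsub>Hom_A M \<Gamma>\<^esub>"
    using assms(3) by (simp_all add: kummer_kernel_def kernel_def additive_group_def)
  have "carlitz M \<alpha> \<in> ?K" using a assms(2,4) kummer_field_facts(1) by blast
  then obtain \<sigma> where \<sigma>: "ac_hom \<sigma>" "\<And>c. c \<in> ?K \<Longrightarrow> \<sigma> c = c" "\<sigma> \<alpha> \<noteq> \<alpha>"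
    using ac_hom_moving_division[OF assms(1) kummer_field_facts(1)[of M] _ _ _ \<alpha>]
    unfolding cyclotomic_field_def using adjoin_closed(2,3) by metis
  have mem: "restrict \<sigma> (kummer_field M \<Gamma>) \<in> carrier (kummer_group M \<Gamma>)" (is "?\<sigma> \<in> _")
    by (rule restrict_in_kummer_group[OF assms(1,2) \<sigma>(1,2)])
  have "?\<sigma> \<alpha> - \<alpha> = kummer_map M \<Gamma> a ?\<sigma>"
    using kummer_map_eq[OF mem, of \<alpha>] a(1) assms(4) by simp
  also have "\<dots> = 0" using mem by (simp add: a(2) Hom_A_def Let_def)
  finally have "?\<sigma> \<alpha> = \<alpha>" by simp
  moreover have "\<alpha> \<in> kummer_field M \<Gamma>"
    using kummer_field_facts(4)[of M \<Gamma>] a(1) assms(4) by (auto simp: carlitz_division_def)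
  ultimately show False using \<sigma>(3) by simp
qed

section \<open>Choice of the multiplier and conclusion\<close>

lemma central_multiplier_exists:
  fixes M :: "'a::{finite_field, field_gcd} poly"
  assumes "Polynomial.degree M > 0"
    and "CARD('a) \<noteq> 2 \<or> (CARD('a) = 2 \<and> \<not> [:0, 1:] dvd M \<and> \<not> [:1, 1:] dvd M)"
  obtains B where "coprime B M" "coprime (B - 1) M" "Polynomial.lead_coeff B = 1"
proof (cases "CARD('a) = 2")
  case True
  have cop: "coprime [:a, 1:] M" if "\<not> [:a, 1:] dvd M" for a
    using that by (intro prime_elem_imp_coprime prime_elem_linear_field_poly) auto
  \<comment> \<open>With two field elements \<open>T - 1 = T + 1\<close>, so the excluded divisors
    are exactly \<open>B\<close> and \<open>B - 1\<close> for \<open>B = T\<close>.\<close>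
  have "- 1 = (1 :: 'a)"
  proof (rule ccontr)
    assume "- 1 \<noteq> (1 :: 'a)"
    then have "card {0, 1, - 1 :: 'a} = 3" by auto
    then show False using card_mono[of "UNIV :: 'a set" "{0, 1, - 1}"] True by simp
  qed
  then have "[:0, 1:] - 1 = [:1, 1 :: 'a:]" by (simp add: one_pCons)
  then show ?thesis
    using assms(2) True by (intro that[of "[:0, 1:]"]) (auto intro!: cop)
next
  case False
  then have "CARD('a) > card {0, 1 :: 'a}"
    using card_finite_field_gt_1[where 'a = 'a] by simp
  then have "\<exists>c. c \<notin> {0, 1 :: 'a}"
    by (metis UNIV_eq_I less_irrefl)
  then obtain c :: 'a where c: "c \<noteq> 0" "c \<noteq> 1" by auto
  \<comment> \<open>The monic associate of \<open>M\<close>, so that \<open>c + N\<close> is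
    monic.\<close>
  define N where "N = Polynomial.smult (inverse (Polynomial.lead_coeff M)) M"
  have "M \<noteq> 0" using assms(1) by auto
  have N: "M dvd N" "Polynomial.degree N = Polynomial.degree M" "Polynomial.lead_coeff N = 1"
    using \<open>M \<noteq> 0\<close> by (simp_all add: N_def dvd_smult)
  \<comment> \<open>Modulo \<open>M\<close> the sum is the unit \<open>d\<close>; this serves for
    \<open>d = c\<close> and \<open>d = c - 1\<close>.\<close>
  have cop: "coprime ([:d:] + N) M" if "d \<noteq> 0" for d
  proof (rule coprimeI)
    fix r assume r: "r dvd [:d:] + N" "r dvd M"
    then have "r dvd [:d:]" using N(1) by (metis dvd_add_left_iff dvd_trans)
    moreover have "[:d:] dvd 1" using that by (simp add: is_unit_const_poly_iff dvd_field_iff)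
    ultimately show "r dvd 1" by (rule dvd_trans)
  qed
  have "[:c:] + N - 1 = [:c - 1:] + N" by (simp add: one_pCons)
  moreover have "Polynomial.lead_coeff ([:c:] + N) = 1"
    using N assms(1) by (subst lead_coeff_add_le) auto
  ultimately show ?thesis
    using c cop[of c] cop[of "c - 1"] that[of "[:c:] + N"] by (metis right_minus_eq)
qed

theorem theorem2p9:
  fixes M :: "'a::{finite_field, field_gcd} poly"
    and \<Gamma> :: "'a kbar set"
  assumes "Polynomial.degree M > 0"
    and "CARD('a) \<noteq> 2 \<or> (CARD('a) = 2 \<and> \<not> [:0, 1:] dvd M \<and> \<not> [:1, 1:] dvd M)"
    and "carlitz.subspace \<Gamma>"
    and "\<exists>S. finite S \<and> \<Gamma> = carlitz.span S"
    and "\<Gamma> \<subseteq> range to_ac"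
  shows "carlitz (e_M M \<Gamma>) ` kummer_kernel M \<Gamma> \<subseteq> carlitz M ` \<Gamma>"
proof (rule image_subsetI)
  fix a assume a: "a \<in> kummer_kernel M \<Gamma>"
  then have a\<Gamma>: "a \<in> \<Gamma>" by (simp add: kummer_kernel_def kernel_def additive_group_def)
  have M: "M \<noteq> 0" using assms(1) by auto
  obtain \<alpha> where \<alpha>: "carlitz M \<alpha> = a" using carlitz_surj[OF M] .
  obtain B where B: "coprime B M" "coprime (B - 1) M" "Polynomial.lead_coeff B = 1"
    using central_multiplier_exists[OF assms(1,2)] .
  obtain \<sigma> where \<sigma>: "ac_hom \<sigma>" "\<And>x. x \<in> carlitz_torsion M \<Longrightarrow> \<sigma> x = carlitz B x"
    using frobenius_exists[OF M B(1,3)] by blast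
  have "carlitz M \<alpha> \<in> range to_ac" using \<alpha> a\<Gamma> assms(5) by blast
  then obtain \<beta> where \<beta>: "\<beta> \<in> range to_ac" "carlitz M \<beta> = a"
    using division_point_descent[OF M kummer_kernel_division_point[OF M assms(5) a \<alpha>] _ \<sigma> B(2)] \<alpha>
    by metis
  define \<Gamma>' where "\<Gamma>' = carlitz_division M \<Gamma> \<inter> range to_ac"
  define e where "e = quotient_exponent \<Gamma>' \<Gamma>"
  \<comment> \<open>\<open>quotient_exponent_unique\<close> also says that the minimum is attained,
    so \<open>e\<close> itself maps \<Gamma>' into \<Gamma>.\<close>
  have "carlitz e ` \<Gamma>' \<subseteq> \<Gamma>"
    using quotient_exponent_unique[OF M assms(3), of \<Gamma>' e]
    by (auto simp: \<Gamma>'_def e_def is_arg_min_def)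
  moreover have "\<beta> \<in> \<Gamma>'" using \<beta> a\<Gamma> by (simp add: \<Gamma>'_def carlitz_division_def)
  ultimately have e\<beta>: "carlitz e \<beta> \<in> \<Gamma>" by blast
  obtain u v where uv: "u * e + v * M = e_M M \<Gamma>"
    using bezout_coefficients_fst_snd[of e M] by (metis e_M_def e_def \<Gamma>'_def)
  have "carlitz (e_M M \<Gamma>) \<beta> = carlitz u (carlitz e \<beta>) + carlitz v a"
    using \<beta>(2) by (simp add: carlitz_left_add carlitz_mult flip: uv del: carlitz.scale_scale)
  also have "\<dots> \<in> \<Gamma>"
    by (intro carlitz.subspace_add carlitz.subspace_scale assms(3) e\<beta> a\<Gamma>)
  finally have "carlitz (e_M M \<Gamma>) \<beta> \<in> \<Gamma>" .
  moreover have "carlitz (e_M M \<Gamma>) a = carlitz M (carlitz (e_M M \<Gamma>) \<beta>)"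
    unfolding \<beta>(2)[symmetric] by (rule carlitz.scale_left_commute)
  ultimately show "carlitz (e_M M \<Gamma>) a \<in> carlitz M ` \<Gamma>" by blast
qed

end
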